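(* The only parameter set $(n,r,c)$ corresponding to an abelian drackn that gives a set of complex equiangular lines in dimension $\overline{m_\tau}$ of maximum size is $(9,3,3)$. That is, there exists an abelian $(n,r,c)$-drackn with $n=\overline{m_\tau}^{\,2}$ if and only if $(n,r,c)=(9,3,3)$.
   Context: An $r$-fold cover of $K_n$ is a simple graph on $rn$ vertices whose vertex set is partitioned into $n$ sets of size $r$ (fibres) such that no two vertices in the same fibre are adjacent and the edges between any two distinct fibres form a perfect matching. An $(n,r,c)$-drackn (distance-regular antipodal cover of $K_n$; $n,r\ge 2$, $c\ge 1$) is an $r$-fold cover of $K_n$ that is an antipodal distance-regular graph of diameter $3$ whose antipodal classes are the fibres, in which any two vertices at distance two have exactly $c$ common neighbours. With $\delta=n-rc-2$, its distinct eigenvalues are $n-1$ (multiplicity $1$), $-1$ (multiplicity $n-1$), and $\theta=\frac{\delta+\sqrt{\delta^2+4(n-1)}}{2}>0$, $\tau=\frac{\delta-\sqrt{\delta^2+4(n-1)}}{2}<0$ with multiplicities $m_\theta$ and $m_\tau$; $\overline{m_\tau}=m_\tau/(r-1)$. An arc function of index $r$ over $K_n$ is a function $f$ from the arcs (ordered pairs of distinct vertices) of $K_n$ to $\mathrm{Sym}(r)$ with $f(v,u)=f(u,v)^{-1}$; it determines the $r$-fold cover with vertices $(u,i)$, in which the matching from fibre $u$ to fibre $v$ is given by $f(u,v)$. It is normalized if it is the identity on the arcs of some spanning tree of $K_n$. $\langle f\rangle$ is the permutation group generated by the values of $f$. A cover determined by a normalized arc function $f$ is abelian if $\langle f\rangle$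 is abelian and acts regularly on the $r$ points. An abelian drackn gives $n$ complex equiangular lines in dimension $\overline{m_\tau}$: for a non-trivial linear character $\phi$ of $\langle f\rangle$ and the Hermitian matrix $S$ with zero diagonal and entries $\phi(f(u,v))$, the matrix $I-\frac1\theta S$ is their Gram matrix. "Maximum size" means that the absolute bound $n\le d^2$ holds with equality for $d=\overline{m_\tau}$. *)

theory Defs
  imports
    "HOL-Library.Disjoint_Sets"
    "HOL-Algebra.Sym_Groups"
    "HOL-Algebra.Generated_Groups"
    "Graph_Theory.Digraph_Component"
    "Jordan_Normal_Form.Char_Poly"
begin

text \<open>
  Finite simple graphs are the records satisfying \<^locale>\<open>pair_graph\<close>: finite vertex set,
  and an irreflexive symmetric set of arcs, so an edge is a pair of opposite arcs.
\<close>

section \<open>Distance-regular graphs and antipodality\<close>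

text \<open>
  The powers of the arc relation are the walks of given length.  The value is only meaningful
  if some walk exists; below it is only used for connected graphs.
\<close>
definition gdist :: "'a pair_pre_digraph \<Rightarrow> 'a \<Rightarrow> 'a \<Rightarrow> nat" where
  "gdist G u v = (LEAST k. (u, v) \<in> parcs G ^^ k)"

definition diameter :: "'a pair_pre_digraph \<Rightarrow> nat" where
  "diameter G = Max {gdist G u v | u v. u \<in> pverts G \<and> v \<in> pverts G}"

text \<open>
  For each \<open>i\<close> the numbers \<open>b\<close> and \<open>c\<close> are the entries \<open>b\<^sub>i\<close> and \<open>c\<^sub>i\<close> of the intersection array;
  \<open>i = 0\<close> gives regularity of the graph.
\<close>
definition distance_regular :: "'a pair_pre_digraph \<Rightarrow> bool" where
  "distance_regular G \<longleftrightarrow>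
     pair_graph G \<and> Digraph_Component.connected (with_proj G) \<and>
     (\<forall>i. \<exists>b c. \<forall>u \<in> pverts G. \<forall>v \<in> pverts G. gdist G u v = i \<longrightarrow>
        card {w \<in> pverts G. (v, w) \<in> parcs G \<and> gdist G u w = i + 1} = b \<and>
        card {w \<in> pverts G. (v, w) \<in> parcs G \<and> gdist G u w + 1 = i} = c)"

definition antipodal_rel :: "'a pair_pre_digraph \<Rightarrow> 'a rel" where
  "antipodal_rel G = {(u, v). u \<in> pverts G \<and> v \<in> pverts G \<and> (u = v \<or> gdist G u v = diameter G)}"

definition antipodal :: "'a pair_pre_digraph \<Rightarrow> bool" where
  "antipodal G \<longleftrightarrow> equiv (pverts G) (antipodal_rel G)"


section \<open>Covers of complete graphs\<close>

definition cover_of_Kn :: "'a pair_pre_digraph \<Rightarrow> 'a set set \<Rightarrow> nat \<Rightarrow> nat \<Rightarrow> bool" where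
  "cover_of_Kn G F n r \<longleftrightarrow>
     pair_graph G \<and> partition_on (pverts G) F \<and> card F = n \<and> (\<forall>A \<in> F. card A = r) \<and>
     (\<forall>A \<in> F. \<forall>x \<in> A. \<forall>y \<in> A. (x, y) \<notin> parcs G) \<and>
     (\<forall>A \<in> F. \<forall>B \<in> F. A \<noteq> B \<longrightarrow> (\<forall>x \<in> A. \<exists>!y. y \<in> B \<and> (x, y) \<in> parcs G))"

definition drackn :: "'a pair_pre_digraph \<Rightarrow> 'a set set \<Rightarrow> nat \<Rightarrow> nat \<Rightarrow> nat \<Rightarrow> bool" where
  "drackn G F n r c \<longleftrightarrow>
     n \<ge> 2 \<and> r \<ge> 2 \<and> c \<ge> 1 \<and>
     cover_of_Kn G F n r \<and>
     distance_regular G \<and> diameter G = 3 \<and>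
     antipodal G \<and> pverts G // antipodal_rel G = F \<and>
     (\<forall>u \<in> pverts G. \<forall>v \<in> pverts G. gdist G u v = 2 \<longrightarrow>
        card {w \<in> pverts G. (u, w) \<in> parcs G \<and> (w, v) \<in> parcs G} = c)"


section \<open>Arc functions\<close>

definition Kn :: "nat \<Rightarrow> nat pair_pre_digraph" where
  "Kn n = \<lparr> pverts = {1..n}, parcs = {(u, v). u \<in> {1..n} \<and> v \<in> {1..n} \<and> u \<noteq> v} \<rparr>"

text \<open>The values \<open>f u v\<close> at pairs that are not arcs of \<open>Kn n\<close> play no role.\<close>
definition arc_function :: "nat \<Rightarrow> nat \<Rightarrow> (nat \<Rightarrow> nat \<Rightarrow> nat \<Rightarrow> nat) \<Rightarrow> bool" where
  "arc_function n r f \<longleftrightarrow>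
     (\<forall>(u, v) \<in> parcs (Kn n).
        f u v \<in> carrier (sym_group r) \<and> f v u = inv\<^bsub>sym_group r\<^esub> (f u v))"

definition arc_cover :: "nat \<Rightarrow> nat \<Rightarrow> (nat \<Rightarrow> nat \<Rightarrow> nat \<Rightarrow> nat) \<Rightarrow> (nat \<times> nat) pair_pre_digraph" where
  "arc_cover n r f =
     \<lparr> pverts = {1..n} \<times> {1..r},
       parcs = {((u, i), (v, j)). (u, v) \<in> parcs (Kn n) \<and> i \<in> {1..r} \<and> j \<in> {1..r} \<and> f u v i = j} \<rparr>"

definition fibres :: "nat \<Rightarrow> nat \<Rightarrow> (nat \<times> nat) set set" where
  "fibres n r = {{u} \<times> {1..r} | u. u \<in> {1..n}}"

text \<open>
  \<^const>\<open>Digraph_Component.tree\<close> is unusable for graphs with edges represented as pairs of opposite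
  arcs: the library counts a walk back and forth along one edge as a cycle.  Cycles of a simple
  graph are those of length at least 3.
\<close>
definition spanning_tree_of :: "'a pair_pre_digraph \<Rightarrow> 'a pair_pre_digraph \<Rightarrow> bool" where
  "spanning_tree_of T G \<longleftrightarrow>
     pair_graph T \<and> spanning (with_proj T) (with_proj G) \<and>
     Digraph_Component.connected (with_proj T) \<and>
     \<not> (\<exists>p. pre_digraph.cycle (with_proj T) p \<and> length p \<ge> 3)"

definition normalized :: "nat \<Rightarrow> nat \<Rightarrow> (nat \<Rightarrow> nat \<Rightarrow> nat \<Rightarrow> nat) \<Rightarrow> bool" where
  "normalized n r f \<longleftrightarrow>
     (\<exists>T. spanning_tree_of T (Kn n) \<and> (\<forall>(u, v) \<in> parcs T. f u v = \<one>\<^bsub>sym_group r\<^esub>))"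

definition arc_group :: "nat \<Rightarrow> nat \<Rightarrow> (nat \<Rightarrow> nat \<Rightarrow> nat \<Rightarrow> nat) \<Rightarrow> (nat \<Rightarrow> nat) monoid" where
  "arc_group n r f =
     (sym_group r) \<lparr> carrier := generate (sym_group r) {f u v | u v. (u, v) \<in> parcs (Kn n)} \<rparr>"

definition acts_regularly :: "(nat \<Rightarrow> nat) monoid \<Rightarrow> nat \<Rightarrow> bool" where
  "acts_regularly H r \<longleftrightarrow>
     (\<forall>i \<in> {1..r}. \<forall>j \<in> {1..r}. \<exists>g \<in> carrier H. g i = j) \<and>
     (\<forall>g \<in> carrier H. \<forall>i \<in> {1..r}. g i = i \<longrightarrow> g = \<one>\<^bsub>H\<^esub>)"

definition abelian_drackn :: "nat \<Rightarrow> nat \<Rightarrow> nat \<Rightarrow> (nat \<Rightarrow> nat \<Rightarrow> nat \<Rightarrow> nat) \<Rightarrow> bool" where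
  "abelian_drackn n r c f \<longleftrightarrow>
     arc_function n r f \<and> normalized n r f \<and>
     comm_group (arc_group n r f) \<and> acts_regularly (arc_group n r f) r \<and>
     drackn (arc_cover n r f) (fibres n r) n r c"


section \<open>The eigenvalue tau and its multiplicity\<close>

definition adj_matrix :: "'a pair_pre_digraph \<Rightarrow> 'a list \<Rightarrow> real mat" where
  "adj_matrix G vs =
     mat (length vs) (length vs) (\<lambda>(a, b). if (vs ! a, vs ! b) \<in> parcs G then 1 else 0)"

definition delta :: "nat \<Rightarrow> nat \<Rightarrow> nat \<Rightarrow> real" where
  "delta n r c = real n - real r * real c - 2"

definition tau :: "nat \<Rightarrow> nat \<Rightarrow> nat \<Rightarrow> real" where
  "tau n r c = (delta n r c - sqrt ((delta n r c)\<^sup>2 + 4 * (real n - 1))) / 2"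

text \<open>The list product enumerates \<open>pverts (arc_cover n r f)\<close> without repetition.\<close>
definition m_tau :: "nat \<Rightarrow> nat \<Rightarrow> nat \<Rightarrow> (nat \<Rightarrow> nat \<Rightarrow> nat \<Rightarrow> nat) \<Rightarrow> nat" where
  "m_tau n r c f =
     Polynomial.order (tau n r c)
       (char_poly (adj_matrix (arc_cover n r f) (List.product [1..<n+1] [1..<r+1])))"

text \<open>
  For an abelian drackn this is the dimension spanned by the equiangular lines with Gram matrix
  \<open>I - S / \<theta>\<close>.  The division is one of reals, so no rounding is involved.
\<close>
definition m_tau_bar :: "nat \<Rightarrow> nat \<Rightarrow> nat \<Rightarrow> (nat \<Rightarrow> nat \<Rightarrow> nat \<Rightarrow> nat) \<Rightarrow> real" where
  "m_tau_bar n r c f = real (m_tau n r c f) / (real r - 1)"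

end

theory Submission
  imports Defs "Jordan_Normal_Form.Schur_Decomposition" "HOL-Algebra.Multiplicative_Group"
begin

text \<open>
  For a non-trivial character \<open>\<phi>\<close> of the group of an abelian drackn, the matrix \<open>S\<close> with entries
  \<open>\<phi> (f u v)\<close> satisfies \<open>S\<^sup>2 = (n - 1) I + \<delta> S\<close> and has trace 0, so \<open>\<theta> I - S\<close> has rank
  \<open>d = n \<theta> / (\<theta> - \<tau>)\<close>, which is the number called \<open>m_tau_bar\<close>.  If \<open>n = d\<^sup>2\<close>, then
  \<open>\<theta>\<^sup>2 = d + 1\<close>.  The Hadamard square of \<open>\<theta> I - S\<close> is \<open>\<theta>\<^sup>2 I + T\<close>, where \<open>T\<close> is the matrix of the
  character \<open>\<phi>\<^sup>2\<close>; its rank is at most \<open>d (d + 1) / 2 < n\<close>, so \<open>- \<theta>\<^sup>2\<close> is an eigenvalue of \<open>T\<close>.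
  For trivial \<open>\<phi>\<^sup>2\<close> this is absurd, because \<open>T = J - I\<close>; otherwise the quadratic equation for \<open>T\<close>
  gives \<open>\<delta> = - 2\<close> and \<open>d = 3\<close>, and counting leaves only \<open>r = c = 3\<close>.  Conversely, the symplectic form
  on \<open>\<int>\<^sub>3 \<times> \<int>\<^sub>3\<close> is an arc function of a \<open>(9, 3, 3)\<close>-drackn.
\<close>

section \<open>Traces and factorizations of complex matrices\<close>

text \<open>All that is used of a character matrix is its zero diagonal and its quadratic equation;
  its factorization through dimension \<open>d\<close> comes from a Schur triangular form with a
  prescribed order of the eigenvalues. Passing to the symmetric square is essential: the full tensor
  square has dimension \<open>d^2 = n\<close>, which forces nothing, whereas
  \<open>d (d + 1) / 2\<close> drops below \<open>n\<close> as soon as \<open>d > 1\<close>. The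
  link between the cover and its character matrix is numerical: the multiplicity of
  \<open>tau\<close> is computed from closed walks of length at most 3 in the cover, the rank
  \<open>d\<close> from the trace of the character matrix, and \<open>d\<close> is that multiplicity
  divided by \<open>r - 1\<close> because both numbers are determined by the same linear equation.
  Distances occur only at the interface to the definition of a drackn; everything else works with
  the number of common neighbours of two nonadjacent vertices in different fibres.\<close>

definition mtrace :: "'a :: semiring_1 mat \<Rightarrow> 'a" where
  "mtrace A = (\<Sum>i<dim_row A. A $$ (i, i))"

lemma mat_mult_index:
  assumes "A \<in> carrier_mat n m" "B \<in> carrier_mat m k" "i < n" "j < k"
  shows "(A * B) $$ (i, j) = (\<Sum>l<m. A $$ (i, l) * B $$ (l, j))"
  using assms by (auto simp: scalar_prod_def atLeast0LessThan intro!: sum.cong)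

lemma mtrace_comm:
  fixes A B :: "'a :: comm_semiring_1 mat"
  assumes "A \<in> carrier_mat n n" "B \<in> carrier_mat n n"
  shows "mtrace (A * B) = mtrace (B * A)"
proof -
  have "mtrace (A * B) = (\<Sum>i<n. \<Sum>l<n. A $$ (i, l) * B $$ (l, i))"
    unfolding mtrace_def using assms mat_mult_index[OF assms] by simp
  also have "\<dots> = (\<Sum>l<n. \<Sum>i<n. B $$ (l, i) * A $$ (i, l))"
    by (subst sum.swap) (simp add: mult.commute)
  also have "\<dots> = mtrace (B * A)"
    unfolding mtrace_def using assms mat_mult_index[OF assms(2,1)] by simp
  finally show ?thesis .
qed

lemma mtrace_similar:
  fixes A :: "'a :: comm_ring_1 mat"
  assumes "similar_mat_wit A B P Q"
  shows "mtrace A = mtrace B"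
proof -
  define n where "n = dim_row A"
  note w = similar_mat_witD[OF n_def assms]
  have "mtrace A = mtrace (Q * (P * B))"
    unfolding w(3) by (rule mtrace_comm[of _ n]) (use w in auto)
  also have "Q * (P * B) = (Q * P) * B"
    by (rule assoc_mult_mat[symmetric, of _ n n _ n _ n]) (use w in auto)
  finally show ?thesis using w by simp
qed

lemma upper_triangular_mult:
  fixes A B :: "'a :: comm_ring_1 mat"
  assumes A: "A \<in> carrier_mat n n" "upper_triangular A"
    and B: "B \<in> carrier_mat n n" "upper_triangular B"
  shows "upper_triangular (A * B)"
    and "i < n \<Longrightarrow> (A * B) $$ (i, i) = A $$ (i, i) * B $$ (i, i)"
proof -
  have 0: "A $$ (i, l) * B $$ (l, j) = 0"
    if "i < n" "l < n" "l < i \<or> j < l" for i j l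
    using that A B by (auto simp: upper_triangular_def)
  show "upper_triangular (A * B)"
  proof
    fix i j assume ij: "j < i" "i < dim_row (A * B)"
    hence "(A * B) $$ (i, j) = (\<Sum>l<n. A $$ (i, l) * B $$ (l, j))"
      using A B by (intro mat_mult_index[OF A(1) B(1)]) auto
    also have "\<dots> = 0" using ij A by (intro sum.neutral ballI 0) auto
    finally show "(A * B) $$ (i, j) = 0" .
  qed
  assume i: "i < n"
  hence "(A * B) $$ (i, i) = (\<Sum>l<n. A $$ (i, l) * B $$ (l, i))"
    using A B by (intro mat_mult_index) auto
  also have "\<dots> = (\<Sum>l\<in>{i}. A $$ (i, l) * B $$ (l, i))"
    by (rule sum.mono_neutral_right) (use i 0 in \<open>auto simp: nat_neq_iff\<close>)
  finally show "(A * B) $$ (i, i) = A $$ (i, i) * B $$ (i, i)" by simp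
qed

lemma upper_triangular_pow:
  fixes A :: "'a :: comm_ring_1 mat"
  assumes A: "A \<in> carrier_mat n n" "upper_triangular A"
  shows "upper_triangular (A ^\<^sub>m k) \<and> (\<forall>i<n. (A ^\<^sub>m k) $$ (i, i) = (A $$ (i, i)) ^ k)"
proof (induction k)
  case 0
  show ?case using A by auto
next
  case (Suc k)
  have "A ^\<^sub>m k \<in> carrier_mat n n" using A by simp
  with upper_triangular_mult[OF this _ A] Suc show ?case by (auto simp: mult.commute)
qed

text \<open>The trace is invariant under similarity, and the diagonal of a power of a triangular
  matrix consists of powers. So a Schur form turns every power trace into a power sum of the
  eigenvalues with algebraic multiplicity; one list \<open>es\<close> serves all exponents.\<close>

lemma mtrace_pow_spectrum:
  fixes A :: "complex mat"
  assumes A: "A \<in> carrier_mat n n"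
  obtains es where "char_poly A = (\<Prod>e\<leftarrow>es. [:- e, 1:])" "length es = n"
    "\<And>e. e \<in> set es \<Longrightarrow> eigenvalue A e"
    "\<And>k. mtrace (A ^\<^sub>m k) = (\<Sum>e\<leftarrow>es. e ^ k)"
proof -
  from char_poly_factorized[OF A] obtain es
    where es: "char_poly A = (\<Prod>e\<leftarrow>es. [:- e, 1:])" "length es = n" by auto
  obtain B P Q where BPQ: "schur_decomposition A es = (B, P, Q)"
    by (cases "schur_decomposition A es")
  note sch = schur_decomposition[OF A es(1) BPQ]
  hence B: "B \<in> carrier_mat n n" and ut: "upper_triangular B" and diag: "diag_mat B = es"
    using A similar_mat_witD2(5)[OF A] by auto
  have "mtrace (A ^\<^sub>m k) = (\<Sum>e\<leftarrow>es. e ^ k)" for k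
  proof -
    have "mtrace (A ^\<^sub>m k) = mtrace (B ^\<^sub>m k)"
      using sch by (intro mtrace_similar[OF similar_mat_wit_pow]) auto
    also have "\<dots> = (\<Sum>i<n. (B $$ (i, i)) ^ k)"
      using upper_triangular_pow[OF B ut] B by (simp add: mtrace_def)
    also have "\<dots> = (\<Sum>e\<leftarrow>diag_mat B. e ^ k)"
      using B by (simp add: diag_mat_def sum_list_distinct_conv_sum_set o_def atLeast0LessThan)
    finally show ?thesis using diag by simp
  qed
  moreover have "eigenvalue A e" if "e \<in> set es" for e
    unfolding eigenvalue_root_char_poly[OF A] es(1) linear_poly_root[OF that] ..
  ultimately show ?thesis using es that by blast
qed

text \<open>Links the order of a root, by which \<open>m_tau\<close> is defined, to the number of
  occurrences in a list of eigenvalues.\<close>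

lemma order_linear_factors:
  "order (a :: 'a :: idom) (\<Prod>e\<leftarrow>es. [:- e, 1:]) = count_list es a"
proof (induction es)
  case (Cons e es)
  have "(\<Prod>e\<leftarrow>es. [:- e, 1:]) \<noteq> 0" by (auto simp: prod_list_zero_iff)
  hence "order a (\<Prod>e\<leftarrow>e # es. [:- e, 1:]) = order a [:- e, 1:] + order a (\<Prod>e\<leftarrow>es. [:- e, 1:])"
    by (simp add: order_mult del: mult_pCons_left)
  also have "order a [:- e, 1:] = (if e = a then 1 else 0)"
    using order_power_n_n[of a 1] by (auto intro: order_0I)
  finally show ?case using Cons by simp
qed simp

text \<open>\<open>m_tau\<close> refers to a real polynomial, the spectrum is complex. The cofactor
  left after splitting off all factors \<open>[:- a, 1:]\<close> does not vanish at
  \<open>a\<close>, and this survives the embedding.\<close>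

lemma order_of_real_poly:
  assumes "p \<noteq> 0"
  shows "order (complex_of_real a) (map_poly complex_of_real p) = order a p"
proof -
  from order_decomp[OF assms, of a] obtain q
    where q: "p = [:- a, 1:] ^ order a p * q" "\<not> [:- a, 1:] dvd q" by blast
  let ?h = "map_poly complex_of_real"
  interpret h: map_poly_inj_idom_hom complex_of_real ..
  have qa: "poly q a \<noteq> 0" using q(2) by (simp add: poly_eq_0_iff_dvd)
  have "poly (?h q) (complex_of_real a) = complex_of_real (poly q a)"
    by (rule of_real_hom.poly_map_poly)
  with qa have hq: "order (complex_of_real a) (?h q) = 0" by (intro order_0I) simp
  have "?h p = [:- complex_of_real a, 1:] ^ order a p * ?h q"
    by (subst q(1)) (simp add: h.hom_mult h.hom_power)
  moreover from this have "\<dots> \<noteq> 0" using assms by (metis h.hom_0_iff)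
  ultimately show ?thesis
    using hq by (simp add: order_mult order_power_n_n)
qed

text \<open>Isolates one multiplicity in a spectral sum. The intended \<open>f\<close> is a
  polynomial vanishing at all other eigenvalues, so that \<open>b = 0\<close>.\<close>

lemma sum_list_count_split:
  assumes "\<And>e. e \<in> set es \<Longrightarrow> e \<noteq> a \<Longrightarrow> f e = (b :: 'a :: comm_ring_1)"
  shows "(\<Sum>e\<leftarrow>es. f e) = of_nat (count_list es a) * f a + (of_nat (length es) - of_nat (count_list es a)) * b"
  using assms
proof (induction es)
  case (Cons e es)
  hence "(\<Sum>e\<leftarrow>es. f e) = of_nat (count_list es a) * f a + (of_nat (length es) - of_nat (count_list es a)) * b"
    by auto
  with Cons.prems show ?case by (cases "e = a") (auto simp: algebra_simps)
qed simp

text \<open>A factorization through fewer than \<open>n\<close> indices bounds the rank. Padding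
  both factors to size \<open>n\<close> makes the determinant multiplicative, and the left factor
  acquires a zero column.\<close>

lemma det_eq_0_of_small_inner_dim:
  fixes M :: "'a :: field mat"
  assumes M: "M \<in> carrier_mat n n"
    and I: "finite I" "card I < n"
    and eq: "\<And>i j. i < n \<Longrightarrow> j < n \<Longrightarrow> M $$ (i, j) = (\<Sum>a\<in>I. x i a * y a j)"
  shows "det M = 0"
proof -
  obtain h where h: "bij_betw h {0..<card I} I" using ex_bij_betw_nat_finite[OF I(1)] by blast
  define X where "X = mat n n (\<lambda>(i, k). if k < card I then x i (h k) else 0)"
  \<comment> \<open>The rows of \<open>Y\<close> from \<open>card I\<close> on hold arbitrary
    values; they only meet zero columns of \<open>X\<close>.\<close>
  define Y where "Y = mat n n (\<lambda>(k, j). y (h k) j)"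
  have XY: "X \<in> carrier_mat n n" "Y \<in> carrier_mat n n" by (auto simp: X_def Y_def)
  have "M = X * Y"
  proof (rule eq_matI)
    fix i j assume "i < dim_row (X * Y)" "j < dim_col (X * Y)"
    hence ij: "i < n" "j < n" using XY by auto
    have "(X * Y) $$ (i, j) = (\<Sum>l<n. X $$ (i, l) * Y $$ (l, j))"
      by (rule mat_mult_index[OF XY ij])
    also have "\<dots> = (\<Sum>l\<in>{0..<card I}. x i (h l) * y (h l) j)"
      by (rule sum.mono_neutral_cong_right) (use ij I in \<open>auto simp: X_def Y_def\<close>)
    also have "\<dots> = (\<Sum>a\<in>I. x i a * y a j)"
      by (rule sum.reindex_bij_betw[OF h])
    finally show "M $$ (i, j) = (X * Y) $$ (i, j)" using eq[OF ij] by simp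
  qed (use M XY in auto)
  moreover have "det X = 0"
  proof -
    have "X *\<^sub>v unit_vec n (card I) = 0\<^sub>v n"
      using I by (auto simp: X_def)
    thus ?thesis using det_0_iff_vec_prod_zero_field[OF XY(1)] I(2)
      by (metis unit_vec_carrier unit_vec_nonzero)
  qed
  ultimately show ?thesis by (simp add: det_mult[OF XY])
qed

text \<open>The tensor square of a vector lies in the symmetric square.\<close>
lemma square_sum_symmetric:
  fixes x y :: "nat \<Rightarrow> 'a :: comm_ring_1"
  shows "(\<Sum>k<d. x k * y k)\<^sup>2 =
    (\<Sum>(l, k)\<in>(SIGMA l:{..<d}. {..l}). (x l * x k) * ((if k = l then 1 else 2) * (y l * y k)))"
proof -
  have "(\<Sum>k<d. x k * y k)\<^sup>2 =
    (\<Sum>l<d. \<Sum>k\<le>l. (x l * x k) * ((if k = l then 1 else 2) * (y l * y k)))"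
  proof (induction d)
    case (Suc d)
    have *: "(\<Sum>k\<le>d. (x d * x k) * ((if k = d then 1 else 2) * (y d * y k)))
        = 2 * (x d * y d) * (\<Sum>k<d. x k * y k) + (x d * y d)\<^sup>2"
      by (simp add: lessThan_Suc_atMost[symmetric] sum_distrib_left power2_eq_square algebra_simps)
    have "(\<Sum>k<Suc d. x k * y k)\<^sup>2 =
        (\<Sum>k<d. x k * y k)\<^sup>2 + (2 * (x d * y d) * (\<Sum>k<d. x k * y k) + (x d * y d)\<^sup>2)"
      by (simp add: power2_sum algebra_simps)
    thus ?case unfolding Suc *[symmetric] by simp
  qed simp
  thus ?thesis by (simp add: sum.Sigma)
qed

lemma card_triangle: "2 * card (SIGMA l:{..<d}. {..l::nat}) = d * (d + 1)"
  by (simp add: card_SigmaI, induction d) auto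

section \<open>Matrices annihilated by a quadratic polynomial\<close>

lemma eigenvalue_imp_eigenfunction:
  fixes A :: "'a :: field mat"
  assumes A: "A \<in> carrier_mat n n" and e: "eigenvalue A e"
  obtains v i where "i < n" "v i \<noteq> 0" "\<And>i. i < n \<Longrightarrow> (\<Sum>j<n. A $$ (i, j) * v j) = e * v i"
proof -
  obtain v where v: "v \<in> carrier_vec n" "v \<noteq> 0\<^sub>v n" "A *\<^sub>v v = e \<cdot>\<^sub>v v"
    using e A by (auto simp: eigenvalue_def eigenvector_def)
  obtain i where i: "i < n" "v $ i \<noteq> 0"
    using v(1,2) by (metis eq_vecI carrier_vecD index_zero_vec)
  have "(\<Sum>j<n. A $$ (i, j) * v $ j) = e * v $ i" if "i < n" for i
  proof -
    have "(\<Sum>j<n. A $$ (i, j) * v $ j) = (A *\<^sub>v v) $ i"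
      using A v(1) that by (auto simp: scalar_prod_def atLeast0LessThan intro!: sum.cong)
    thus ?thesis using v that by simp
  qed
  from i this show ?thesis by (rule that)
qed

text \<open>Applying \<open>A\<close> twice to an eigenvector evaluates \<open>A * A\<close> in two
  ways.\<close>

lemma eigenvalue_quadratic:
  fixes A :: "'a :: field mat"
  assumes A: "A \<in> carrier_mat n n" and quad: "A * A = p \<cdot>\<^sub>m 1\<^sub>m n + q \<cdot>\<^sub>m A"
    and e: "eigenvalue A e"
  shows "e\<^sup>2 = p + q * e"
proof -
  obtain v i where v: "i < n" "v i \<noteq> 0"
    and ev: "\<And>i. i < n \<Longrightarrow> (\<Sum>j<n. A $$ (i, j) * v j) = e * v i"
    using eigenvalue_imp_eigenfunction[OF A e] by metis
  have "(\<Sum>j<n. (A * A) $$ (i, j) * v j) = (\<Sum>j<n. \<Sum>l<n. A $$ (i, l) * (A $$ (l, j) * v j))"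
    using mat_mult_index[OF A A] v(1) by (simp add: sum_distrib_right mult.assoc)
  also have "\<dots> = (\<Sum>l<n. A $$ (i, l) * (\<Sum>j<n. A $$ (l, j) * v j))"
    by (subst sum.swap) (simp add: sum_distrib_left)
  also have "\<dots> = (\<Sum>l<n. e * (A $$ (i, l) * v l))"
    by (intro sum.cong) (auto simp: ev)
  also have "\<dots> = e\<^sup>2 * v i"
    using v(1) by (simp add: ev power2_eq_square flip: sum_distrib_left)
  finally have "e\<^sup>2 * v i = (\<Sum>j<n. (A * A) $$ (i, j) * v j)" ..
  also have "\<dots> = (\<Sum>j<n. (if i = j then p * v j else 0) + q * (A $$ (i, j) * v j))"
    unfolding quad using A v(1) by (intro sum.cong) (auto simp: algebra_simps)
  also have "\<dots> = (p + q * e) * v i"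
    using v(1) by (simp add: sum.distrib ev distrib_right mult.assoc flip: sum_distrib_left)
  finally show ?thesis using v(2) by simp
qed

text \<open>Since the roots differ, \<open>\<theta> I - S\<close> is a nonzero scalar times an
  idempotent. In a Schur form \<open>B\<close> listing \<open>\<theta>\<close> first, the leading
  block of \<open>\<theta> I - B\<close> is strictly triangular, and the idempotent relation forces
  it to vanish. Only the last \<open>d\<close> columns survive, so the algebraic multiplicity
  \<open>d\<close> of \<open>\<tau>\<close> is also the inner dimension of a factorization.\<close>

lemma quadratic_matrix_factor:
  fixes S :: "complex mat"
  assumes S: "S \<in> carrier_mat n n"
    and quad: "S * S = (- \<theta> * \<tau>) \<cdot>\<^sub>m 1\<^sub>m n + (\<theta> + \<tau>) \<cdot>\<^sub>m S"
    and ne: "\<theta> \<noteq> \<tau>"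
  obtains d x y where "d \<le> n" "mtrace S = of_nat (n - d) * \<theta> + of_nat d * \<tau>"
    "\<And>i j. i < n \<Longrightarrow> j < n \<Longrightarrow> (if i = j then \<theta> else 0) - S $$ (i, j) = (\<Sum>k<d. x i k * y k j)"
proof -
  obtain es where es: "char_poly S = (\<Prod>e\<leftarrow>es. [:- e, 1:])" "length es = n"
    "\<And>e. e \<in> set es \<Longrightarrow> eigenvalue S e" "\<And>k. mtrace (S ^\<^sub>m k) = (\<Sum>e\<leftarrow>es. e ^ k)"
    using mtrace_pow_spectrum[OF S] by metis
  have ev: "e = \<theta> \<or> e = \<tau>" if "e \<in> set es" for e
  proof -
    have "e\<^sup>2 = - \<theta> * \<tau> + (\<theta> + \<tau>) * e"
      by (rule eigenvalue_quadratic[OF S quad es(3)[OF that]])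
    hence "(e - \<theta>) * (e - \<tau>) = 0" by (simp add: algebra_simps power2_eq_square)
    thus ?thesis by simp
  qed
  define d where "d = count_list es \<tau>"
  have d: "d \<le> n" using es(2) count_le_length by (metis d_def)
  \<comment> \<open>Schur triangularization realizes any order of the eigenvalues; this one puts
    \<open>n - d\<close> zeros at the start of the diagonal of
    \<open>\<theta> I - B\<close>.\<close>
  define bs where "bs = replicate (n - d) \<theta> @ replicate d \<tau>"
  have mset: "mset es = mset bs"
  proof (rule multiset_eqI)
    have "count_list es \<theta> + count_list es \<tau> = length es"
      using ev ne by (induction es) auto
    hence c: "count_list es \<theta> = n - d" using es(2) by (simp add: d_def)
    have repl: "count_list (replicate k a) b = (if a = b then k else 0)" for k and a b :: complex
      by (induction k) auto
    fix e show "count (mset es) e = count (mset bs) e"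
    proof (cases "e = \<theta> \<or> e = \<tau>")
      case True
      thus ?thesis using c ne by (auto simp: count_mset bs_def d_def repl)
    next
      case False
      with ev have "e \<notin> set es" by blast
      with False show ?thesis by (simp add: count_mset bs_def repl)
    qed
  qed
  hence "char_poly S = (\<Prod>e\<leftarrow>bs. [:- e, 1:])"
    unfolding es(1) by (metis mset_map prod_mset_prod_list)
  moreover obtain B P Q where "schur_decomposition S bs = (B, P, Q)"
    by (cases "schur_decomposition S bs")
  ultimately have wit: "similar_mat_wit S B P Q" and ut: "upper_triangular B" and diag: "diag_mat B = bs"
    using schur_decomposition[OF S] by auto
  note w = similar_mat_witD2[OF S wit]
  define R where "R = \<theta> \<cdot>\<^sub>m 1\<^sub>m n - S"
  define T where "T = \<theta> \<cdot>\<^sub>m 1\<^sub>m n - B"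
  have R: "R \<in> carrier_mat n n" and T: "T \<in> carrier_mat n n"
    using S w by (auto simp: R_def T_def)
  have RR: "R * R = (\<theta> - \<tau>) \<cdot>\<^sub>m R"
  proof -
    have "R * R = \<theta> \<cdot>\<^sub>m R - S * R"
      by (subst (1) R_def, subst minus_mult_distrib_mat[of _ n n _ _ n]) (use S R in auto)
    also have "S * R = \<theta> \<cdot>\<^sub>m S - S * S"
      unfolding R_def by (subst mult_minus_distrib_mat[of _ n n _ n]) (use S in auto)
    finally show ?thesis
      unfolding quad using S by (intro eq_matI) (auto simp: R_def algebra_simps)
  qed
  have PTQ: "R = P * T * Q"
  proof -
    have "P * T = \<theta> \<cdot>\<^sub>m P - P * B"
      unfolding T_def using w by (subst mult_minus_distrib_mat[of _ n n _ n]) auto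
    hence "P * T * Q = \<theta> \<cdot>\<^sub>m (P * Q) - P * B * Q"
      using w by (simp add: minus_mult_distrib_mat[of _ n n _ _ n] mult_smult_assoc_mat[of _ n n _ n])
    thus ?thesis using w by (simp add: R_def)
  qed
  have TT: "T * T = (\<theta> - \<tau>) \<cdot>\<^sub>m T"
  proof -
    have T': "T = Q * R * P"
    proof -
      have "Q * R * P = (Q * P) * T * (Q * P)"
        unfolding PTQ using w(4-) T by (simp add: assoc_mult_mat[of _ n n _ n _ n])
      thus ?thesis unfolding w(2) using T by simp
    qed
    have "T * T = Q * R * (P * Q) * (R * P)"
      unfolding T' using w(4-) R by (simp add: assoc_mult_mat[of _ n n _ n _ n])
    also have "\<dots> = Q * (R * R) * P"
      unfolding w(1) using w(4-) R by (simp add: assoc_mult_mat[of _ n n _ n _ n])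
    also have "\<dots> = (\<theta> - \<tau>) \<cdot>\<^sub>m T"
      unfolding RR T' using w(4-) R by (simp add: mult_smult_distrib[of _ n n _ n] mult_smult_assoc_mat[of _ n n _ n])
    finally show ?thesis .
  qed
  have Tut: "T $$ (i, j) = 0" if "j < i" "i < n" for i j
    using that ut w by (auto simp: T_def upper_triangular_def)
  have Tdiag: "T $$ (i, i) = 0" if "i < n - d" for i
  proof -
    have "B $$ (i, i) = diag_mat B ! i" using that w by (simp add: diag_mat_def)
    also have "\<dots> = \<theta>" unfolding diag bs_def using that by (simp add: nth_append)
    finally show ?thesis using that w by (simp add: T_def)
  qed
  \<comment> \<open>Induction on the distance from the diagonal: every summand of the entry
    \<open>(i, j)\<close> of \<open>T * T\<close> contains a zero diagonal entry, an entry below the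
    diagonal, or an entry closer to the diagonal. What remains is that
    \<open>(\<theta> - \<tau>)\<close> times the entry of \<open>T\<close> is zero.\<close>
  have T0: "T $$ (i, j) = 0" if "i < n - d" "j < n - d" for i j
    using that
  proof (induction "j - i" arbitrary: i j rule: less_induct)
    case less
    have ij: "i < n" "j < n" using less.prems by auto
    have "(\<theta> - \<tau>) * T $$ (i, j) = (\<Sum>l<n. T $$ (i, l) * T $$ (l, j))"
      using mat_mult_index[OF T T ij] ij T by (simp add: TT)
    also have "\<dots> = 0"
    proof (intro sum.neutral ballI)
      fix l assume l: "l \<in> {..<n}"
      consider "l < i" | "j < l" | "l = i" | "l = j" | "i < l" "l < j" by linarith
      thus "T $$ (i, l) * T $$ (l, j) = 0"
      proof cases
        case 5
        thus ?thesis using less.hyps[of l i] less.prems by auto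
      qed (use l ij less.prems Tut Tdiag in auto)
    qed
    finally show ?case using ne by simp
  qed
  show ?thesis
  proof (rule that[OF d])
    show "mtrace S = of_nat (n - d) * \<theta> + of_nat d * \<tau>"
    proof -
      have "mtrace S = sum_list es" using es(4)[of 1] S by simp
      also have "\<dots> = sum_list bs" using mset by (metis sum_mset_sum_list)
      finally show ?thesis by (simp add: bs_def sum_list_replicate)
    qed
    fix i j assume ij: "i < n" "j < n"
    have "(if i = j then \<theta> else 0) - S $$ (i, j) = (P * T * Q) $$ (i, j)"
      unfolding PTQ[symmetric] R_def using ij S by simp
    also have "\<dots> = (\<Sum>l<n. (P * T) $$ (i, l) * Q $$ (l, j))"
      by (rule mat_mult_index) (use w T ij in auto)
    also have "\<dots> = (\<Sum>l\<in>{n-d..<n}. (P * T) $$ (i, l) * Q $$ (l, j))"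
    proof (rule sum.mono_neutral_right)
      show "\<forall>l\<in>{..<n} - {n-d..<n}. (P * T) $$ (i, l) * Q $$ (l, j) = 0"
      proof
        fix l assume "l \<in> {..<n} - {n-d..<n}"
        hence l: "l < n - d" by auto
        \<comment> \<open>Column \<open>l\<close> of \<open>T\<close> is zero: its upper part lies
          in the vanishing block, its lower part below the diagonal.\<close>
        have "(P * T) $$ (i, l) = (\<Sum>m<n. P $$ (i, m) * T $$ (m, l))"
          by (rule mat_mult_index[of P n n T n]) (use w(4-) T ij l in auto)
        also have "\<dots> = 0"
        proof (intro sum.neutral ballI)
          fix m assume "m \<in> {..<n}"
          thus "P $$ (i, m) * T $$ (m, l) = 0"
            using T0[of m l] Tut[of l m] l by (cases "m < n - d") auto
        qed
        finally show "(P * T) $$ (i, l) * Q $$ (l, j) = 0" by simp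
      qed
    qed auto
    also have "\<dots> = (\<Sum>k<d. (P * T) $$ (i, n - d + k) * Q $$ (n - d + k, j))"
      by (rule sum.reindex_bij_witness[of _ "\<lambda>k. n - d + k" "\<lambda>l. l - (n - d)"]) (use d in auto)
    finally show "(if i = j then \<theta> else 0) - S $$ (i, j) =
      (\<Sum>k<d. (P * T) $$ (i, n - d + k) * Q $$ (n - d + k, j))" .
  qed
qed

text \<open>The zero diagonal of \<open>S\<close> is used twice: it gives trace zero, which
  determines \<open>d\<close>, and it makes the entrywise square of \<open>\<theta> I - S\<close>
  equal to \<open>char_matrix T (- \<theta>\<^sup>2)\<close>. A square of a sum of \<open>d\<close>
  products needs only the index pairs \<open>k \<le> l\<close>, and fewer than \<open>n\<close>
  pairs force determinant zero.\<close>

lemma hadamard_square_eigenvalue: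
  fixes S T :: "complex mat"
  assumes S: "S \<in> carrier_mat n n" "\<And>i. i < n \<Longrightarrow> S $$ (i, i) = 0"
    and quad: "S * S = (- \<theta> * \<tau>) \<cdot>\<^sub>m 1\<^sub>m n + (\<theta> + \<tau>) \<cdot>\<^sub>m S"
    and ne: "\<theta> \<noteq> \<tau>"
    and T: "T \<in> carrier_mat n n" "\<And>i j. i < n \<Longrightarrow> j < n \<Longrightarrow> T $$ (i, j) = (S $$ (i, j))\<^sup>2"
  obtains d where "of_nat n * \<theta> = of_nat d * (\<theta> - \<tau>)"
    "d * (d + 1) < 2 * n \<Longrightarrow> eigenvalue T (- \<theta>\<^sup>2)"
proof -
  obtain d x y where d: "d \<le> n" "mtrace S = of_nat (n - d) * \<theta> + of_nat d * \<tau>"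
    and xy: "\<And>i j. i < n \<Longrightarrow> j < n \<Longrightarrow> (if i = j then \<theta> else 0) - S $$ (i, j) = (\<Sum>k<d. x i k * y k j)"
    by (rule quadratic_matrix_factor[OF S(1) quad ne]) (rule that)
  have "mtrace S = 0" using S by (simp add: mtrace_def)
  with d have "of_nat n * \<theta> = of_nat d * (\<theta> - \<tau>)" by (simp add: of_nat_diff algebra_simps)
  moreover have "eigenvalue T (- \<theta>\<^sup>2)" if small: "d * (d + 1) < 2 * n"
  proof -
    let ?I = "SIGMA l:{..<d}. {..l}"
    have "det (char_matrix T (- \<theta>\<^sup>2)) = 0"
    proof (rule det_eq_0_of_small_inner_dim[of _ n ?I])
      show "card ?I < n" using small card_triangle[of d] by linarith
      fix i j assume ij: "i < n" "j < n"
      have "char_matrix T (- \<theta>\<^sup>2) $$ (i, j) = ((if i = j then \<theta> else 0) - S $$ (i, j))\<^sup>2"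
        using ij S T by (auto simp: char_matrix_def)
      also have "\<dots> = (\<Sum>(l, k)\<in>?I. (x i l * x i k) * ((if k = l then 1 else 2) * (y l j * y k j)))"
        unfolding xy[OF ij] by (rule square_sum_symmetric)
      finally show "char_matrix T (- \<theta>\<^sup>2) $$ (i, j) =
          (\<Sum>a\<in>?I. (x i (fst a) * x i (snd a)) *
            ((if snd a = fst a then 1 else 2) * (y (fst a) j * y (snd a) j)))"
        by (simp add: case_prod_beta')
    qed (use T in \<open>auto simp: char_matrix_def\<close>)
    thus ?thesis using eigenvalue_det[OF T(1)] by simp
  qed
  ultimately show ?thesis by (rule that)
qed

section \<open>Characters of finite abelian groups\<close>

lemma (in comm_group) subgroup_adjoin:
  assumes H: "subgroup H G" and g: "g \<in> carrier G"
  shows "subgroup {h \<otimes> g [^] (k :: int) | h k. h \<in> H} G" (is "subgroup ?K G")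
proof -
  interpret H: subgroup H G by fact
  have mult: "(h \<otimes> g [^] k) \<otimes> (h' \<otimes> g [^] k') = (h \<otimes> h') \<otimes> g [^] (k + k')"
    if "h \<in> H" "h' \<in> H" for h h' and k k' :: int
    using that g by (simp add: int_pow_mult m_ac)
  show ?thesis
  proof (rule subgroupI)
    show "?K \<subseteq> carrier G" using g by auto
    show "?K \<noteq> {}" using H.one_closed by blast
  next
    fix x assume "x \<in> ?K"
    then obtain h k where x: "x = h \<otimes> g [^] (k :: int)" "h \<in> H" by blast
    hence "inv x = inv h \<otimes> g [^] (- k)"
      using g by (simp add: inv_mult int_pow_neg)
    thus "inv x \<in> ?K" using x(2) H.m_inv_closed by blast
  next
    fix x y assume "x \<in> ?K" "y \<in> ?K"
    thus "x \<otimes> y \<in> ?K" using mult H.m_closed by (auto, metis)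
  qed
qed

text \<open>A maximal proper subgroup has cyclic quotient, generated by any element outside of it.\<close>
lemma (in comm_group) ex_nontrivial_character:
  assumes fin: "finite (carrier G)" and nontriv: "carrier G \<noteq> {\<one>}"
  obtains \<phi> :: "'a \<Rightarrow> complex" and g where "g \<in> carrier G" "\<phi> g \<noteq> 1" "\<phi> \<one> = 1"
    "\<And>x y. x \<in> carrier G \<Longrightarrow> y \<in> carrier G \<Longrightarrow> \<phi> (x \<otimes> y) = \<phi> x * \<phi> y"
proof -
  let ?Sub = "{H. subgroup H G \<and> H \<noteq> carrier G}"
  have "?Sub \<subseteq> Pow (carrier G)" using subgroup.subset by blast
  hence "finite ?Sub" using fin by (meson finite_Pow_iff finite_subset)
  moreover have "{\<one>} \<in> ?Sub" using nontriv triv_subgroup by simp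
  ultimately obtain H where "H \<in> ?Sub" and max: "\<And>K. K \<in> ?Sub \<Longrightarrow> H \<subseteq> K \<Longrightarrow> H = K"
    using finite_has_maximal[of ?Sub] by blast
  hence H: "subgroup H G" "H \<noteq> carrier G" by auto
  interpret H: subgroup H G by fact
  obtain g where g: "g \<in> carrier G" "g \<notin> H" using H.subset H(2) by blast
  have gen: "\<exists>h\<in>H. \<exists>k::int. x = h \<otimes> g [^] k" if "x \<in> carrier G" for x
  proof -
    let ?K = "{h \<otimes> g [^] (k :: int) | h k. h \<in> H}"
    have "h \<in> ?K" if "h \<in> H" for h
    proof -
      have "h = h \<otimes> g [^] (0 :: int)" using that by simp
      thus ?thesis using that by blast
    qed
    hence "H \<subseteq> ?K" by blast
    moreover have "g \<in> ?K"
    proof -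
      have "g = \<one> \<otimes> g [^] (1 :: int)" using g by (simp add: int_pow_1)
      thus ?thesis using H.one_closed by blast
    qed
    ultimately have "?K = carrier G" using max[of ?K] g subgroup_adjoin[OF H(1) g(1)] by blast
    thus ?thesis using that by blast
  qed
  \<comment> \<open>\<open>p\<close> is the order of \<open>g\<close> modulo
    \<open>H\<close>.\<close>
  define p where "p = (LEAST m. 0 < m \<and> g [^] (m :: nat) \<in> H)"
  have "0 < ord g" "g [^] ord g \<in> H"
    using ord_ge_1[OF fin g(1)] pow_ord_eq_1[OF g(1)] H.one_closed by auto
  hence p: "0 < p" "g [^] p \<in> H"
    unfolding p_def using LeastI[of "\<lambda>m. 0 < m \<and> g [^] (m :: nat) \<in> H" "ord g"] by auto
  have least: "m = 0" if "m < p" "g [^] m \<in> H" for m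
    using not_less_Least[of m "\<lambda>m. 0 < m \<and> g [^] (m :: nat) \<in> H"] that unfolding p_def by auto
  have dvd: "int p dvd k" if k: "g [^] (k :: int) \<in> H" for k
  proof -
    define q where "q = nat (k mod int p)"
    have q: "int q = k mod int p" "q < p" using p(1) by (auto simp: q_def nat_less_iff)
    define c where "c = - (k div int p)"
    have "int q = k + int p * c"
      unfolding q(1) c_def by (simp add: minus_mult_div_eq_mod[symmetric])
    hence "g [^] q = g [^] (k + int p * c)" by (metis int_pow_int)
    also have "\<dots> = g [^] k \<otimes> (g [^] p) [^] c"
      using g(1) int_pow_pow[of g "int p" c] by (simp add: int_pow_mult int_pow_int)
    also have "\<dots> \<in> H"
      using k p(2) subgroup_int_pow_closed[OF H(1)] by blast
    finally have "q = 0" using least q(2) by blast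
    thus ?thesis using q(1) by auto
  qed
  \<comment> \<open>\<open>\<omega>\<close> is a character of the integers of period
    \<open>p\<close>. The exponent of \<open>g\<close> in a decomposition modulo \<open>H\<close> is
    determined up to multiples of \<open>p\<close>, so the choice made in \<open>\<phi>\<close>
    below does not matter.\<close>
  define \<omega> where "\<omega> = (\<lambda>k :: int. cis (2 * pi * (of_int k / of_nat p)))"
  have \<omega>_add: "\<omega> (k + l) = \<omega> k * \<omega> l" for k l
    by (simp add: \<omega>_def cis_mult add_divide_distrib distrib_left)
  have \<omega>_1: "\<omega> k = 1" if k: "int p dvd k" for k
  proof -
    obtain m where "k = int p * m" using k by (elim dvdE)
    hence "of_int k / of_nat p = (of_int m :: real)" using p(1) by simp
    thus ?thesis unfolding \<omega>_def by (metis Ints_of_int cis_multiple_2pi)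
  qed
  define \<phi> where "\<phi> = (\<lambda>x. \<omega> (SOME k. \<exists>h\<in>H. x = h \<otimes> g [^] k))"
  have \<phi>: "\<phi> (h \<otimes> g [^] k) = \<omega> k" if "h \<in> H" for h and k :: int
  proof -
    define l where "l = (SOME l :: int. \<exists>h'\<in>H. h \<otimes> g [^] k = h' \<otimes> g [^] l)"
    have "\<exists>h'\<in>H. h \<otimes> g [^] k = h' \<otimes> g [^] l"
      unfolding l_def by (rule someI_ex) (use that in blast)
    then obtain h' where h': "h' \<in> H" "h \<otimes> g [^] k = h' \<otimes> g [^] l" by blast
    have c: "h \<in> carrier G" "h' \<in> carrier G" using that h' by auto
    have "g [^] (k - l) = g [^] k \<otimes> inv (g [^] l)"
      using g(1) by (simp add: int_pow_diff)
    also have "g [^] k = inv h \<otimes> (h' \<otimes> g [^] l)"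
      using h'(2)[symmetric] c g(1) by (simp add: m_assoc[symmetric])
    also have "\<dots> \<otimes> inv (g [^] l) = inv h \<otimes> h'"
      using c g(1) by (simp add: m_assoc)
    also have "\<dots> \<in> H" using that h' by blast
    finally have "\<omega> (k - l) = 1" using dvd \<omega>_1 by blast
    hence "\<omega> k = \<omega> l" using \<omega>_add[of "k - l" l] by simp
    thus ?thesis by (simp add: \<phi>_def l_def)
  qed
  show ?thesis
  proof (rule that)
    show "g \<in> carrier G" by fact
    \<comment> \<open>\<open>p = 1\<close> would put \<open>g\<close> into \<open>H\<close>; so
      \<open>\<omega> 1\<close> is a root of unity of order at least 2.\<close>
    have "p \<noteq> 1" using p(2) g by auto
    with p have p2: "2 \<le> p" by simp
    have "\<phi> g = \<omega> 1" using \<phi>[of "\<one>" 1] g(1) by (simp add: int_pow_1)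
    moreover have "\<omega> 1 \<noteq> 1"
    proof
      assume "\<omega> 1 = 1"
      hence "cos (2 * pi / p) = 1" by (simp add: \<omega>_def complex_eq_iff)
      then obtain m :: int where "2 * pi / p = of_int m * 2 * pi"
        using cos_one_2pi_int by auto
      hence "of_int (m * int p) = (1 :: real)" using p(1) by (simp add: field_simps)
      hence "m * int p = 1" by linarith
      with p2 show False by (simp add: zmult_eq_1_iff)
    qed
    ultimately show "\<phi> g \<noteq> 1" by simp
    show "\<phi> \<one> = 1" using \<phi>[of "\<one>" 0] \<omega>_1[of 0] by simp
    fix x y assume xy: "x \<in> carrier G" "y \<in> carrier G"
    obtain h k where x: "h \<in> H" "x = h \<otimes> g [^] (k :: int)" using gen[OF xy(1)] by blast
    obtain h' k' where y: "h' \<in> H" "y = h' \<otimes> g [^] (k' :: int)" using gen[OF xy(2)] by blast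
    have "x \<otimes> y = (h \<otimes> h') \<otimes> g [^] (k + k')"
      using x y g by (simp add: int_pow_mult m_ac)
    thus "\<phi> (x \<otimes> y) = \<phi> x * \<phi> y"
      using x y \<phi> \<omega>_add H.m_closed by metis
  qed
qed

text \<open>Translation by \<open>g\<close> permutes the group and multiplies the sum by
  \<open>\<phi> g\<close>, which is not 1.\<close>

lemma (in group) sum_character:
  fixes \<phi> :: "'a \<Rightarrow> 'c :: field"
  assumes hom: "\<And>x y. x \<in> carrier G \<Longrightarrow> y \<in> carrier G \<Longrightarrow> \<phi> (x \<otimes> y) = \<phi> x * \<phi> y"
    and g: "g \<in> carrier G" "\<phi> g \<noteq> 1"
  shows "(\<Sum>x\<in>carrier G. \<phi> x) = 0"
proof -
  have "bij_betw (\<lambda>x. g \<otimes> x) (carrier G) (carrier G)"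
    using g(1) by (intro bij_betwI[where g = "\<lambda>x. inv g \<otimes> x"]) (auto simp: m_assoc[symmetric])
  hence "(\<Sum>x\<in>carrier G. \<phi> x) = (\<Sum>x\<in>carrier G. \<phi> (g \<otimes> x))"
    by (rule sum.reindex_bij_betw[symmetric])
  also have "\<dots> = \<phi> g * (\<Sum>x\<in>carrier G. \<phi> x)"
    using hom g(1) by (simp add: sum_distrib_left)
  finally show ?thesis using g(2) by simp
qed

section \<open>Covers with uniform numbers of common neighbours\<close>

text \<open>The arcs are already symmetric, so the symmetric closure in the definition of
  connectedness adds nothing.\<close>

lemma connected_pair_graph_iff:
  assumes "pair_graph G"
  shows "Digraph_Component.connected (with_proj G) \<longleftrightarrow>
    pverts G \<noteq> {} \<and> (\<forall>x\<in>pverts G. \<forall>y\<in>pverts G. (x, y) \<in> (parcs G)\<^sup>*)"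
proof -
  interpret pair_graph G by fact
  have sym: "Digraph.symmetric (with_proj G)" by (rule pair_sym_arcs)
  have eq: "parcs (mk_symmetric (with_proj G)) = parcs G"
    using adj_mk_symmetric_eq[OF sym] by simp
  have "(x, y) \<in> rtrancl_on (pverts G) (parcs G) \<longleftrightarrow> (x, y) \<in> (parcs G)\<^sup>*"
    if "x \<in> pverts G" "y \<in> pverts G" for x y
    using that rtrancl_on_rtranclI rtrancl_consistent_rtrancl_on[of x y "parcs G" "pverts G"]
      in_arcsD2 by (metis)
  thus ?thesis
    unfolding Digraph_Component.connected_def strongly_connected_def reachable_def
    by (auto simp: eq)
qed

lemma gdist_eqI:
  assumes "(x, y) \<in> parcs G ^^ k" "\<And>l. l < k \<Longrightarrow> (x, y) \<notin> parcs G ^^ l"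
  shows "gdist G x y = k"
  unfolding gdist_def using assms by (intro Least_equality) (auto simp: not_less[symmetric])

lemma gdist_walk:
  assumes "(x, y) \<in> (parcs G)\<^sup>*"
  shows "(x, y) \<in> parcs G ^^ gdist G x y"
  unfolding gdist_def using assms by (auto simp: rtrancl_power intro: LeastI)

lemma gdist_le_diameter:
  assumes "finite (pverts G)" "x \<in> pverts G" "y \<in> pverts G"
  shows "gdist G x y \<le> diameter G"
proof -
  have "{gdist G u v | u v. u \<in> pverts G \<and> v \<in> pverts G}
      = (\<lambda>(u, v). gdist G u v) ` (pverts G \<times> pverts G)" by auto
  thus ?thesis unfolding diameter_def using assms by (intro Max_ge) auto
qed

text \<open>For an arc function, \<open>(u, i)\<close> has exactly one neighbour
  \<open>(w, f u w i)\<close> in each other fibre, so a common neighbour of \<open>(u, i)\<close>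
  and \<open>(v, j)\<close> is recorded by its fibre \<open>w\<close> alone.\<close>

definition common_nbrs :: "nat \<Rightarrow> (nat \<Rightarrow> nat \<Rightarrow> nat \<Rightarrow> nat) \<Rightarrow> nat \<Rightarrow> nat \<Rightarrow> nat \<Rightarrow> nat \<Rightarrow> nat set" where
  "common_nbrs n f u i v j = {w \<in> {1..n} - {u, v}. f w v (f u w i) = j}"

text \<open>The combinatorial content of a drackn, stated without distances:
  \<open>u \<noteq> v\<close> and \<open>f u v i \<noteq> j\<close> mean that \<open>(u, i)\<close>
  and \<open>(v, j)\<close> are nonadjacent vertices of different fibres.\<close>

definition uniform_arc_function :: "nat \<Rightarrow> nat \<Rightarrow> nat \<Rightarrow> (nat \<Rightarrow> nat \<Rightarrow> nat \<Rightarrow> nat) \<Rightarrow> bool" where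
  "uniform_arc_function n r c f \<longleftrightarrow>
     (\<forall>u\<in>{1..n}. \<forall>v\<in>{1..n}. \<forall>i\<in>{1..r}. \<forall>j\<in>{1..r}.
        u \<noteq> v \<longrightarrow> f u v i \<noteq> j \<longrightarrow> card (common_nbrs n f u i v j) = c)"

section \<open>Adjacency in the cover of an arc function\<close>

locale arc_fun =
  fixes n r :: nat and f :: "nat \<Rightarrow> nat \<Rightarrow> nat \<Rightarrow> nat"
  assumes arc: "arc_function n r f"
begin

abbreviation G where "G \<equiv> arc_cover n r f"

lemma f_arc:
  assumes "u \<in> {1..n}" "v \<in> {1..n}" "u \<noteq> v"
  shows "f u v \<in> carrier (sym_group r)" "f v u = inv\<^bsub>sym_group r\<^esub> (f u v)"
proof -
  have "(u, v) \<in> parcs (Kn n)" using assms by (simp add: Kn_def)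
  from bspec[OF arc[unfolded arc_function_def] this]
  show "f u v \<in> carrier (sym_group r)" "f v u = inv\<^bsub>sym_group r\<^esub> (f u v)" by blast+
qed

lemma f_permutes: "u \<in> {1..n} \<Longrightarrow> v \<in> {1..n} \<Longrightarrow> u \<noteq> v \<Longrightarrow> f u v permutes {1..r}"
  using f_arc(1) by (simp add: sym_group_carrier)

lemma f_inv: "f v u (f u v i) = i" if "u \<in> {1..n}" "v \<in> {1..n}" "u \<noteq> v"
proof -
  have "f v u = inv' (f u v)" using f_arc[OF that] sym_group_inv_equality by metis
  thus ?thesis using permutes_inverses(2)[OF f_permutes[OF that]] by simp
qed

lemma f_in: "f u v i \<in> {1..r}" if "u \<in> {1..n}" "v \<in> {1..n}" "u \<noteq> v" "i \<in> {1..r}"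
  using permutes_in_image[OF f_permutes[OF that(1-3)]] that(4) by blast

lemma f_eq_iff: "f u v i = f u v j \<longleftrightarrow> i = j" if "u \<in> {1..n}" "v \<in> {1..n}" "u \<noteq> v"
  using f_inv[OF that] by metis

lemma f_swap: "f v u j = i \<longleftrightarrow> f u v i = j" if "u \<in> {1..n}" "v \<in> {1..n}" "u \<noteq> v"
  using f_inv[OF that] f_inv[of v u] that by metis

lemma pverts_G: "pverts G = {1..n} \<times> {1..r}"
  by (simp add: arc_cover_def)

lemma arc_iff: "((u, i), (v, j)) \<in> parcs G \<longleftrightarrow>
    u \<in> {1..n} \<and> v \<in> {1..n} \<and> u \<noteq> v \<and> i \<in> {1..r} \<and> j \<in> {1..r} \<and> f u v i = j"
  by (auto simp: arc_cover_def Kn_def)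

lemma arc_sym: "(x, y) \<in> parcs G \<Longrightarrow> (y, x) \<in> parcs G"
  by (cases x; cases y) (auto simp: arc_iff f_inv)

lemma pair_graph_G: "pair_graph G"
proof
  show "finite (parcs G)"
    by (rule finite_subset[of _ "pverts G \<times> pverts G"]) (auto simp: pverts_G arc_iff)
  show "Digraph.symmetric (with_proj G)"
    using arc_sym by (auto simp: Digraph.symmetric_def intro!: symI)
qed (auto simp: pverts_G arc_iff)

lemma bij_common_nbrs:
  assumes "u \<in> {1..n}" "i \<in> {1..r}" "v \<in> {1..n}" "j \<in> {1..r}"
  shows "bij_betw (\<lambda>w. (w, f u w i)) (common_nbrs n f u i v j)
    {z \<in> pverts G. ((u, i), z) \<in> parcs G \<and> (z, (v, j)) \<in> parcs G}"
  by (rule bij_betwI[where g = fst]) (use assms f_in[of u _ i] in \<open>auto simp: common_nbrs_def pverts_G arc_iff\<close>)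

lemma card_common_nbrs:
  assumes "u \<in> {1..n}" "i \<in> {1..r}" "v \<in> {1..n}" "j \<in> {1..r}"
  shows "card {z \<in> pverts G. ((u, i), z) \<in> parcs G \<and> (z, (v, j)) \<in> parcs G}
    = card (common_nbrs n f u i v j)"
  using bij_betw_same_card[OF bij_common_nbrs[OF assms]] by simp

lemma card_nbrs:
  assumes "v \<in> {1..n}" "j \<in> {1..r}"
  shows "card {z \<in> pverts G. ((v, j), z) \<in> parcs G \<and> P z} = card {w \<in> {1..n} - {v}. P (w, f v w j)}"
proof -
  have "bij_betw (\<lambda>w. (w, f v w j)) {w \<in> {1..n} - {v}. P (w, f v w j)}
    {z \<in> pverts G. ((v, j), z) \<in> parcs G \<and> P z}"
    by (rule bij_betwI[where g = fst]) (use assms f_in[of v _ j] in \<open>auto simp: pverts_G arc_iff\<close>)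
  thus ?thesis by (rule bij_betw_same_card[symmetric])
qed

text \<open>Nonadjacent vertices of different fibres are at distance 2: by the diameter the only
  alternative is 3, and then they would share an antipodal class, which is a fibre.\<close>

lemma uniform_of_drackn:
  assumes dr: "drackn G (fibres n r) n r c"
  shows "uniform_arc_function n r c f"
  unfolding uniform_arc_function_def
proof (intro ballI impI)
  fix u v i j assume u: "u \<in> {1..n}" and v: "v \<in> {1..n}" and i: "i \<in> {1..r}" and j: "j \<in> {1..r}"
    and uv: "u \<noteq> v" and nadj: "f u v i \<noteq> j"
  have V: "(u, i) \<in> pverts G" "(v, j) \<in> pverts G" using u v i j by (auto simp: pverts_G)
  have "Digraph_Component.connected (with_proj G)" and diam: "diameter G = 3"
    and quot: "pverts G // antipodal_rel G = fibres n r"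
    using dr by (auto simp: drackn_def distance_regular_def)
  hence walk: "((u, i), (v, j)) \<in> parcs G ^^ gdist G (u, i) (v, j)"
    using V connected_pair_graph_iff[OF pair_graph_G] by (intro gdist_walk) auto
  have "gdist G (u, i) (v, j) \<noteq> 0"
    using walk uv by (metis Pair_inject relpow_0_E)
  moreover have "gdist G (u, i) (v, j) \<noteq> 1"
    using walk nadj by (auto simp: arc_iff)
  moreover have "gdist G (u, i) (v, j) \<noteq> 3"
  proof
    assume "gdist G (u, i) (v, j) = 3"
    hence "{(u, i), (v, j)} \<subseteq> antipodal_rel G `` {(u, i)}"
      using V diam by (auto simp: antipodal_rel_def)
    moreover have "antipodal_rel G `` {(u, i)} \<in> fibres n r"
      using V quot by (auto simp: quotient_def)
    then obtain w where "antipodal_rel G `` {(u, i)} = {w} \<times> {1..r}"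
      unfolding fibres_def by blast
    ultimately have "{(u, i), (v, j)} \<subseteq> {w} \<times> {1..r}" by simp
    thus False using uv by simp
  qed
  moreover have "gdist G (u, i) (v, j) \<le> 3"
    using gdist_le_diameter[OF _ V] diam by (simp add: pverts_G)
  ultimately have "gdist G (u, i) (v, j) = 2" by linarith
  thus "card (common_nbrs n f u i v j) = c"
    using dr V card_common_nbrs[OF u i v j] by (auto simp: drackn_def)
qed

end

locale uniform_arc_fun = arc_fun +
  fixes c :: nat
  assumes uniform: "uniform_arc_function n r c f"
    and n2: "2 \<le> n" and r2: "2 \<le> r" and c1: "1 \<le> c"
begin

lemma card_common:
  assumes "u \<in> {1..n}" "v \<in> {1..n}" "i \<in> {1..r}" "j \<in> {1..r}" "u \<noteq> v" "f u v i \<noteq> j"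
  shows "card (common_nbrs n f u i v j) = c"
  using uniform assms by (auto simp: uniform_arc_function_def)

text \<open>Each of the \<open>n - 2\<close> remaining fibres carries one two-step walk from
  \<open>(u, i)\<close> into fibre \<open>v\<close>. The \<open>r - 1\<close> nonneighbours there
  receive \<open>c\<close> of these walks each, the neighbour receives the rest.\<close>

lemma card_common_adjacent:
  assumes u: "u \<in> {1..n}" and v: "v \<in> {1..n}" and i: "i \<in> {1..r}" and uv: "u \<noteq> v"
  shows "card (common_nbrs n f u i v (f u v i)) + (r - 1) * c = n - 2"
proof -
  let ?g = "\<lambda>w. f w v (f u w i)"
  have "card ({1..n} - {u, v}) = (\<Sum>j\<in>{1..r}. card {w \<in> {1..n} - {u, v}. ?g w = j})"
  proof -
    have "?g ` ({1..n} - {u, v}) \<subseteq> {1..r}" using f_in u v i by blast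
    hence "card ({1..n} - {u, v}) = (\<Sum>j\<in>{1..r}. \<Sum>w\<in>{w \<in> {1..n} - {u, v}. ?g w = j}. 1)"
      using sum.group[of "{1..n} - {u, v}" "{1..r}" ?g "\<lambda>_. 1 :: nat"] by simp
    thus ?thesis by simp
  qed
  also have "\<dots> = (\<Sum>j\<in>{1..r}. card (common_nbrs n f u i v j))"
    by (simp add: common_nbrs_def)
  also have "\<dots> = card (common_nbrs n f u i v (f u v i)) +
      (\<Sum>j\<in>{1..r} - {f u v i}. card (common_nbrs n f u i v j))"
    using f_in[OF u v uv i] by (intro sum.remove) auto
  also have "(\<Sum>j\<in>{1..r} - {f u v i}. card (common_nbrs n f u i v j)) = (\<Sum>j\<in>{1..r} - {f u v i}. c)"
    using u v i uv by (intro sum.cong refl card_common) auto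
  also have "\<dots> = (r - 1) * c" using f_in[OF u v uv i] by simp
  also have "card ({1..n} - {u, v}) = n - 2" using u v uv by (simp add: card_Diff_subset)
  finally show ?thesis ..
qed

text \<open>The number of triangles on an edge is not negative. This excludes \<open>r = 9\<close>,
  \<open>c = 1\<close> once \<open>n = 9\<close> and \<open>r * c = 9\<close> are known.\<close>

lemma parameter_bound: "(r - 1) * c \<le> n - 2"
  using card_common_adjacent[of 1 2 1] n2 r2 by simp

end

section \<open>Distances and intersection numbers of the cover\<close>

context uniform_arc_fun
begin

lemma two_walk:
  assumes "u \<in> {1..n}" "v \<in> {1..n}" "i \<in> {1..r}" "j \<in> {1..r}" "u \<noteq> v" "f u v i \<noteq> j"
  shows "((u, i), (v, j)) \<in> parcs G ^^ 2"
proof -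
  have "common_nbrs n f u i v j \<noteq> {}" using card_common[OF assms] c1 by auto
  then obtain w where "w \<in> {1..n}" "w \<noteq> u" "w \<noteq> v" "f w v (f u w i) = j"
    by (auto simp: common_nbrs_def)
  hence "((u, i), (w, f u w i)) \<in> parcs G" "((w, f u w i), (v, j)) \<in> parcs G"
    using assms f_in[of u w i] by (auto simp: arc_iff)
  thus ?thesis by (auto simp: numeral_2_eq_2)
qed

lemma gdist_G:
  assumes "u \<in> {1..n}" "v \<in> {1..n}" "i \<in> {1..r}" "j \<in> {1..r}"
  shows "((u, i), (v, j)) \<in> (parcs G)\<^sup>*"
    and "gdist G (u, i) (v, j) =
      (if u = v then if i = j then 0 else 3 else if f u v i = j then 1 else 2)"
proof -
  have *: "((u, i), (v, j)) \<in> (parcs G)\<^sup>* \<and> gdist G (u, i) (v, j) = k"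
    if "((u, i), (v, j)) \<in> parcs G ^^ k" "\<And>l. l < k \<Longrightarrow> ((u, i), (v, j)) \<notin> parcs G ^^ l" for k
    using gdist_eqI[OF that] relpow_imp_rtrancl[OF that(1)] by blast
  have less2: "l = 0 \<or> l = 1" if "l < 2" for l :: nat using that by auto
  have less3: "l = 0 \<or> l = 1 \<or> l = 2" if "l < 3" for l :: nat using that by auto
  consider "u = v" "i = j" | "u = v" "i \<noteq> j" | "u \<noteq> v" "f u v i = j" | "u \<noteq> v" "f u v i \<noteq> j"
    by blast
  hence "((u, i), (v, j)) \<in> (parcs G)\<^sup>* \<and> gdist G (u, i) (v, j) =
      (if u = v then if i = j then 0 else 3 else if f u v i = j then 1 else 2)"
  proof cases
    case 1
    thus ?thesis using *[of 0] by simp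
  next
    case 2
    \<comment> \<open>Two points of one fibre: step to another fibre \<open>w\<close>. The neighbour
      of \<open>(w, f u w i)\<close> in fibre \<open>u\<close> is \<open>(u, i)\<close>, so
      \<open>(u, j)\<close> is a nonneighbour in a different fibre and two more steps reach
      it.\<close>
    define w where "w = (if u = 1 then 2 else 1 :: nat)"
    have w: "w \<in> {1..n}" "w \<noteq> u" using n2 by (auto simp: w_def)
    have "((u, i), (w, f u w i)) \<in> parcs G"
      using w assms f_in[of u w i] by (simp add: arc_iff)
    moreover have "((w, f u w i), (v, j)) \<in> parcs G ^^ 2"
      using w assms 2 f_in[of u w i] f_inv[of u w i] by (intro two_walk) auto
    ultimately have "((u, i), (v, j)) \<in> parcs G ^^ 3"
      unfolding eval_nat_numeral(3) by (rule relpow_Suc_I2)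
    \<comment> \<open>A walk of length 2 that returns to its fibre returns to its start, because
      \<open>f w u\<close> inverts \<open>f u w\<close>.\<close>
    moreover have "((u, i), (v, j)) \<notin> parcs G ^^ l" if "l < 3" for l
      using less3[OF that] 2 f_inv
      by (elim disjE) (auto simp: arc_iff numeral_2_eq_2)
    ultimately show ?thesis using *[of 3] 2 by simp
  next
    case 3
    thus ?thesis using *[of 1] assms by (simp add: arc_iff)
  next
    case 4
    have "((u, i), (v, j)) \<notin> parcs G ^^ l" if "l < 2" for l
      using less2[OF that] 4 by (elim disjE) (auto simp: arc_iff)
    thus ?thesis using *[OF two_walk[OF assms 4]] 4 by simp
  qed
  thus "((u, i), (v, j)) \<in> (parcs G)\<^sup>*"
    and "gdist G (u, i) (v, j) =
      (if u = v then if i = j then 0 else 3 else if f u v i = j then 1 else 2)" by blast+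
qed

lemma diameter_G: "diameter G = 3"
proof -
  let ?D = "{gdist G x y | x y. x \<in> pverts G \<and> y \<in> pverts G}"
  have V: "(1, 1) \<in> pverts G" "(1, 2) \<in> pverts G" using n2 r2 by (auto simp: pverts_G)
  moreover have "gdist G (1, 1) (1, 2) = 3" using gdist_G(2)[of 1 1 1 2] n2 r2 by simp
  ultimately have 3: "3 \<in> ?D" by (intro CollectI exI[of _ "(1, 1)"] exI[of _ "(1, 2)"]) auto
  have le: "d \<le> 3" if "d \<in> ?D" for d
    using that by (auto simp: pverts_G gdist_G(2))
  have "?D \<subseteq> {..3}" using le by blast
  hence "finite ?D" by (rule finite_subset) simp
  thus ?thesis unfolding diameter_def using 3 le by (intro Max_eqI) auto
qed

lemma antipodal_rel_G:
  "antipodal_rel G = {(x, y). x \<in> pverts G \<and> y \<in> pverts G \<and> fst x = fst y}"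
  by (auto simp: antipodal_rel_def diameter_G pverts_G gdist_G(2) split: if_splits)

lemma cover_of_Kn_G: "cover_of_Kn G (fibres n r) n r"
proof -
  have eq: "fibres n r = (\<lambda>u. {u} \<times> {1..r}) ` {1..n}" by (auto simp: fibres_def)
  have one: "1 \<in> {1..r}" using r2 by simp
  have "partition_on (pverts G) (fibres n r)"
  proof (rule partition_onI)
    show "\<Union> (fibres n r) = pverts G" by (auto simp: eq pverts_G)
    show "{} \<notin> fibres n r" using one unfolding eq by blast
  qed (auto simp: eq disjnt_def)
  moreover have "card (fibres n r) = n"
  proof -
    have "inj_on (\<lambda>u. {u} \<times> {1..r}) {1..n}"
      using one by (intro inj_onI) blast
    thus ?thesis by (simp add: eq card_image)
  qed
  moreover have *: "\<exists>!y. y \<in> {v} \<times> {1..r} \<and> ((u, i), y) \<in> parcs G"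
    if "u \<in> {1..n}" "v \<in> {1..n}" "u \<noteq> v" "i \<in> {1..r}" for u v i
    using that f_in[of u v i] by (intro ex1I[of _ "(v, f u v i)"]) (auto simp: arc_iff)
  moreover have "\<forall>x\<in>A. \<exists>!y. y \<in> B \<and> (x, y) \<in> parcs G"
    if AB: "A \<in> fibres n r" "B \<in> fibres n r" "A \<noteq> B" for A B
  proof
    fix x assume x: "x \<in> A"
    obtain u where u: "u \<in> {1..n}" "A = {u} \<times> {1..r}" using AB(1) unfolding eq by (elim imageE)
    obtain v where v: "v \<in> {1..n}" "B = {v} \<times> {1..r}" using AB(2) unfolding eq by (elim imageE)
    obtain i where i: "x = (u, i)" "i \<in> {1..r}" using x u(2) by auto
    have "u \<noteq> v" using AB(3) u(2) v(2) by blast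
    from *[OF u(1) v(1) this i(2)]
    show "\<exists>!y. y \<in> B \<and> (x, y) \<in> parcs G" unfolding v(2) i(1) .
  qed
  moreover have "\<forall>A\<in>fibres n r. card A = r" by (auto simp: eq)
  moreover have "\<forall>A\<in>fibres n r. \<forall>x\<in>A. \<forall>y\<in>A. (x, y) \<notin> parcs G" by (auto simp: eq arc_iff)
  ultimately show ?thesis
    unfolding cover_of_Kn_def using pair_graph_G by (intro conjI ballI impI) simp_all
qed

text \<open>The intersection array is \<open>{n - 1, (r - 1) c, 1; 1, c, n - 1}\<close>. Neighbours
  of \<open>(v, j)\<close> are counted by their fibres, and the values given for
  \<open>k > 3\<close> are vacuous.\<close>

lemma distance_regular_G: "distance_regular G"
  unfolding distance_regular_def
proof (intro conjI allI)
  show "pair_graph G" by (rule pair_graph_G)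
  show "Digraph_Component.connected (with_proj G)"
    unfolding connected_pair_graph_iff[OF pair_graph_G]
    using gdist_G(1) n2 r2 by (auto simp: pverts_G)
  fix k :: nat
  let ?b = "if k = 0 then n - 1 else if k = 1 then (r - 1) * c else if k = 2 then 1 else 0"
  let ?c = "if k = 0 then 0 else if k = 1 then 1 else if k = 2 then c else n - 1"
  have *: "card {w \<in> {1..n} - {v}. gdist G (u, i) (w, f v w j) = k + 1} = ?b \<and>
      card {w \<in> {1..n} - {v}. gdist G (u, i) (w, f v w j) + 1 = k} = ?c"
    if u: "u \<in> {1..n}" and i: "i \<in> {1..r}" and v: "v \<in> {1..n}" and j: "j \<in> {1..r}"
      and k: "gdist G (u, i) (v, j) = k" for u i v j
  proof -
    have d: "gdist G (u, i) (w, f v w j) = (if u = w then if i = f v w j then 0 else 3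
        else if f u w i = f v w j then 1 else 2)" if "w \<in> {1..n} - {v}" for w
      using gdist_G(2)[of u w i "f v w j"] f_in[of v w j] that u i v j by auto
    have cn: "common_nbrs n f u i v j = {w \<in> {1..n} - {u, v}. f u w i = f v w j}"
      using v by (auto simp: common_nbrs_def f_inv)
    have card1: "card ({1..n} - {v}) = n - 1" using v by simp
    consider "u = v" "i = j" | "u = v" "i \<noteq> j" | "u \<noteq> v" "f u v i = j" | "u \<noteq> v" "f u v i \<noteq> j"
      by blast
    thus ?thesis
    proof cases
      case 1
      hence k0: "k = 0" using k gdist_G(2)[OF u v i j] by simp
      have "{w \<in> {1..n} - {v}. gdist G (u, i) (w, f v w j) = 1} = {1..n} - {v}"
        using 1 d by auto
      thus ?thesis using k0 card1 by simp
    next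
      case 2
      hence k3: "k = 3" using k gdist_G(2)[OF u v i j] by simp
      have d2: "gdist G (u, i) (w, f v w j) = 2" if "w \<in> {1..n} - {v}" for w
        using d[OF that] 2 that f_eq_iff[of v w i j] v by auto
      hence "{w \<in> {1..n} - {v}. gdist G (u, i) (w, f v w j) = 4} = {}"
        "{w \<in> {1..n} - {v}. gdist G (u, i) (w, f v w j) + 1 = 3} = {1..n} - {v}"
        by auto
      thus ?thesis unfolding k3 using card1 by simp
    next
      case 3
      hence k1: "k = 1" using k gdist_G(2)[OF u v i j] by simp
      have fu: "f v u j = i" using f_inv[OF u v 3(1), of i] 3(2) by simp
      have "{w \<in> {1..n} - {v}. gdist G (u, i) (w, f v w j) = 2}
          = ({1..n} - {u, v}) - common_nbrs n f u i v j"
        unfolding cn using d fu by (auto split: if_splits)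
      moreover have "card (({1..n} - {u, v}) - common_nbrs n f u i v j) =
          n - 2 - card (common_nbrs n f u i v j)"
        using u v 3(1) by (subst card_Diff_subset) (auto simp: common_nbrs_def card_Diff_subset)
      moreover have "card (common_nbrs n f u i v j) + (r - 1) * c = n - 2"
        using card_common_adjacent[OF u v i 3(1)] 3(2) by simp
      moreover have "{w \<in> {1..n} - {v}. gdist G (u, i) (w, f v w j) + 1 = 1} = {u}"
        using d fu u 3(1) by (auto split: if_splits)
      ultimately show ?thesis unfolding k1 one_add_one by simp
    next
      case 4
      hence k2: "k = 2" using k gdist_G(2)[OF u v i j] by simp
      have fu: "f v u j \<noteq> i" using f_swap[OF u v 4(1), of j i] 4(2) by simp
      have "{w \<in> {1..n} - {v}. gdist G (u, i) (w, f v w j) = 3} = {u}"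
        using d fu u 4(1) by (auto split: if_splits)
      moreover have "{w \<in> {1..n} - {v}. gdist G (u, i) (w, f v w j) + 1 = 2} = common_nbrs n f u i v j"
      proof -
        have "gdist G (u, i) (w, f v w j) + 1 = 2 \<longleftrightarrow> w \<noteq> u \<and> f u w i = f v w j"
          if "w \<in> {1..n} - {v}" for w
          unfolding d[OF that] by (simp split: if_split)
        hence "{w \<in> {1..n} - {v}. gdist G (u, i) (w, f v w j) + 1 = 2} =
            {w \<in> {1..n} - {v}. w \<noteq> u \<and> f u w i = f v w j}" by blast
        thus ?thesis unfolding cn by blast
      qed
      ultimately show ?thesis unfolding k2 using card_common[OF u v i j 4] by simp
    qed
  qed
  have "card {z \<in> pverts G. (y, z) \<in> parcs G \<and> gdist G x z = k + 1} = ?b \<and>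
      card {z \<in> pverts G. (y, z) \<in> parcs G \<and> gdist G x z + 1 = k} = ?c"
    if xy: "x \<in> pverts G" "y \<in> pverts G" and k: "gdist G x y = k" for x y
  proof -
    obtain u i v j where eq: "x = (u, i)" "y = (v, j)" by (cases x; cases y)
    have uv: "u \<in> {1..n}" "i \<in> {1..r}" "v \<in> {1..n}" "j \<in> {1..r}"
      using xy unfolding eq pverts_G by blast+
    show ?thesis
      unfolding eq card_nbrs[OF uv(3,4)] by (rule *[OF uv k[unfolded eq]])
  qed
  thus "\<exists>b c. \<forall>x\<in>pverts G. \<forall>y\<in>pverts G. gdist G x y = k \<longrightarrow>
      card {z \<in> pverts G. (y, z) \<in> parcs G \<and> gdist G x z = k + 1} = b \<and>
      card {z \<in> pverts G. (y, z) \<in> parcs G \<and> gdist G x z + 1 = k} = c" by blast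
qed

lemma drackn_G: "drackn G (fibres n r) n r c"
proof -
  have "equiv (pverts G) (antipodal_rel G)"
    unfolding antipodal_rel_G by (auto intro!: equivI refl_onI symI transI)
  moreover have "pverts G // antipodal_rel G = fibres n r"
  proof -
    have "antipodal_rel G `` {(u, i)} = {u} \<times> {1..r}" if "(u, i) \<in> pverts G" for u i
      using that by (auto simp: antipodal_rel_G pverts_G)
    hence "pverts G // antipodal_rel G = (\<lambda>(u, i). {u} \<times> {1..r}) ` pverts G"
      by (auto simp: quotient_def)
    also have "\<dots> = fibres n r"
    proof -
      have "1 \<in> {1..r}" using r2 by simp
      thus ?thesis by (force simp: fibres_def pverts_G image_iff)
    qed
    finally show ?thesis .
  qed
  moreover have "card {w \<in> pverts G. (x, w) \<in> parcs G \<and> (w, y) \<in> parcs G} = c"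
    if "x \<in> pverts G" "y \<in> pverts G" "gdist G x y = 2" for x y
  proof -
    obtain u i v j where xy: "x = (u, i)" "y = (v, j)" by (cases x; cases y)
    hence "u \<in> {1..n}" "v \<in> {1..n}" "i \<in> {1..r}" "j \<in> {1..r}"
      using that by (auto simp: pverts_G)
    moreover from this have "u \<noteq> v" "f u v i \<noteq> j"
      using that(3) gdist_G(2)[of u v i j] xy by (auto split: if_splits)
    ultimately show ?thesis using card_common card_common_nbrs xy by simp
  qed
  ultimately show ?thesis
    unfolding drackn_def antipodal_def
    using n2 r2 c1 cover_of_Kn_G distance_regular_G diameter_G by blast
qed

end

section \<open>The multiplicity of tau\<close>

text \<open>The positive root of \<open>X^2 - \<delta> X - (n - 1)\<close>. In this form
  \<open>theta + tau = delta\<close> is immediate and only the product has to be computed.\<close>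

definition theta :: "nat \<Rightarrow> nat \<Rightarrow> nat \<Rightarrow> real" where
  "theta n r c = delta n r c - tau n r c"

lemma theta_tau:
  assumes "2 \<le> n"
  shows "theta n r c * tau n r c = - (real n - 1)" "0 < theta n r c" "tau n r c < 0"
proof -
  define s where "s = sqrt ((delta n r c)\<^sup>2 + 4 * (real n - 1))"
  have pos: "(delta n r c)\<^sup>2 < (delta n r c)\<^sup>2 + 4 * (real n - 1)" using assms by simp
  have s2: "s\<^sup>2 = (delta n r c)\<^sup>2 + 4 * (real n - 1)"
    unfolding s_def using pos by (intro real_sqrt_pow2) (meson less_imp_le order_trans zero_le_power2)
  have "\<bar>delta n r c\<bar> < s"
    unfolding s_def using real_sqrt_less_mono[OF pos] by simp
  moreover have tau: "tau n r c = (delta n r c - s) / 2" by (simp add: tau_def s_def)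
  moreover have theta: "theta n r c = (delta n r c + s) / 2"
    by (simp add: theta_def tau field_simps)
  ultimately show "0 < theta n r c" "tau n r c < 0" by (auto simp: abs_less_iff)
  have "4 * (theta n r c * tau n r c) = (delta n r c)\<^sup>2 - s\<^sup>2"
    unfolding tau theta by (simp add: power2_eq_square field_simps)
  thus "theta n r c * tau n r c = - (real n - 1)" unfolding s2 by simp
qed

context arc_fun
begin

definition adj :: "nat \<times> nat \<Rightarrow> nat \<times> nat \<Rightarrow> real" where
  "adj x y = (if (x, y) \<in> parcs G then 1 else 0)"

lemma adj_commute: "adj x y = adj y x"
  using arc_sym by (auto simp: adj_def)

lemma sum_adj_square_eq_card:
  assumes "u \<in> {1..n}" "i \<in> {1..r}" "v \<in> {1..n}" "j \<in> {1..r}"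
  shows "(\<Sum>z\<in>pverts G. adj (u, i) z * adj z (v, j)) = real (card (common_nbrs n f u i v j))"
proof -
  have "(\<Sum>z\<in>pverts G. adj (u, i) z * adj z (v, j)) =
      (\<Sum>z\<in>pverts G. if ((u, i), z) \<in> parcs G \<and> (z, (v, j)) \<in> parcs G then 1 else 0)"
    by (intro sum.cong) (auto simp: adj_def)
  also have "\<dots> = real (card {z \<in> pverts G. ((u, i), z) \<in> parcs G \<and> (z, (v, j)) \<in> parcs G})"
    by (simp add: sum.If_cases pverts_G Int_def)
  finally show ?thesis using card_common_nbrs[OF assms] by simp
qed

lemma degree_adj:
  assumes "x \<in> pverts G"
  shows "(\<Sum>y\<in>pverts G. adj x y) = real n - 1"
proof -
  obtain u i where x: "x = (u, i)" "u \<in> {1..n}" "i \<in> {1..r}" using assms by (auto simp: pverts_G)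
  have "(\<Sum>y\<in>pverts G. adj x y) = real (card {z \<in> pverts G. (x, z) \<in> parcs G \<and> True})"
    by (simp add: adj_def sum.If_cases pverts_G Int_def)
  also have "\<dots> = real (card ({1..n} - {u}))"
    unfolding x(1) card_nbrs[OF x(2,3)] by (simp add: set_diff_eq)
  finally show ?thesis using x(2) by (simp add: of_nat_diff)
qed

lemma sum_fibre_adj:
  assumes "u \<in> {1..n}" "z \<in> pverts G"
  shows "(\<Sum>i\<in>{1..r}. adj (u, i) z) = (if fst z = u then 0 else 1)"
proof -
  obtain w k where z: "z = (w, k)" "w \<in> {1..n}" "k \<in> {1..r}" using assms by (auto simp: pverts_G)
  show ?thesis
  proof (cases "w = u")
    case True
    thus ?thesis by (simp add: z adj_def arc_iff)
  next
    case False
    have "adj (u, i) z = (if i = f w u k then 1 else 0)" if "i \<in> {1..r}" for i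
      using assms z that False f_swap[of u w k i] by (auto simp: adj_def arc_iff)
    hence "(\<Sum>i\<in>{1..r}. adj (u, i) z) = (\<Sum>i\<in>{1..r}. if i = f w u k then 1 else 0)"
      by (intro sum.cong) auto
    thus ?thesis using z False f_in[of w u k] assms by simp
  qed
qed

lemma bij_verts:
  "bij_betw ((!) (List.product [1..<n+1] [1..<r+1])) {..<n * r} (pverts G)"
  by (rule bij_betw_nth) (auto simp: distinct_product pverts_G)

end

section \<open>Spectrum of the adjacency matrix\<close>

context uniform_arc_fun
begin

text \<open>In matrix form \<open>A\<^sup>2 = (n - 1) I + \<delta> A + c (J - K)\<close>, where
  \<open>K\<close> is the block matrix of the fibres. An edge lies in \<open>\<delta> + c\<close>
  triangles, of which \<open>J - K\<close> already accounts for \<open>c\<close>.\<close>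

lemma adj_square:
  assumes "x \<in> pverts G" "y \<in> pverts G"
  shows "(\<Sum>z\<in>pverts G. adj x z * adj z y) =
    (if x = y then real n - 1 else 0) + delta n r c * adj x y + (if fst x = fst y then 0 else real c)"
proof -
  obtain u i where x: "x = (u, i)" "u \<in> {1..n}" "i \<in> {1..r}" using assms by (auto simp: pverts_G)
  obtain v j where y: "y = (v, j)" "v \<in> {1..n}" "j \<in> {1..r}" using assms by (auto simp: pverts_G)
  have eq: "(\<Sum>z\<in>pverts G. adj x z * adj z y) = real (card (common_nbrs n f u i v j))"
    unfolding x(1) y(1) by (rule sum_adj_square_eq_card) fact+
  consider "u = v" | "u \<noteq> v" "f u v i = j" | "u \<noteq> v" "f u v i \<noteq> j" by blast
  thus ?thesis
  proof cases
    case 1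
    hence "common_nbrs n f u i v j = (if i = j then {1..n} - {u} else {})"
      using f_inv[of u _ i] x(2) by (auto simp: common_nbrs_def)
    thus ?thesis unfolding eq using 1 x y by (simp add: adj_def arc_iff of_nat_diff)
  next
    case 2
    have "real (card (common_nbrs n f u i v j)) + (real r - 1) * real c = real n - 2"
      using arg_cong[OF card_common_adjacent[OF x(2) y(2) x(3) 2(1)], of real] 2(2) n2 r2
      by (simp add: of_nat_diff)
    thus ?thesis unfolding eq using 2 x y by (simp add: adj_def arc_iff delta_def algebra_simps)
  next
    case 3
    thus ?thesis unfolding eq using card_common[OF x(2) y(2) x(3) y(3) 3] x y
      by (simp add: adj_def arc_iff)
  qed
qed

text \<open>Summing the eigenvalue equation over a fibre gives \<open>(e + 1) * s u = t\<close>, and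
  summing this over all fibres gives \<open>(e + 1) * t = n * t\<close>. So away from
  \<open>n - 1\<close> and \<open>-1\<close> all fibre sums vanish, the fibre term in the squared
  adjacency matrix disappears, and a quadratic equation is left.\<close>

lemma eigenfunction_adj:
  fixes g :: "nat \<times> nat \<Rightarrow> complex"
  assumes x0: "x0 \<in> pverts G" "g x0 \<noteq> 0"
    and ev: "\<And>x. x \<in> pverts G \<Longrightarrow> (\<Sum>y\<in>pverts G. of_real (adj x y) * g y) = e * g x"
  shows "e = of_nat n - 1 \<or> e = -1 \<or> e\<^sup>2 = (of_nat n - 1) + of_real (delta n r c) * e"
proof (rule ccontr)
  assume neg: "\<not> ?thesis"
  define s where "s = (\<lambda>u. \<Sum>i\<in>{1..r}. g (u, i))"
  define t where "t = (\<Sum>x\<in>pverts G. g x)"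
  have ts: "t = (\<Sum>u\<in>{1..n}. s u)"
    unfolding t_def s_def pverts_G by (simp add: sum.cartesian_product)
  have other_fibres: "(\<Sum>y\<in>pverts G. (if fst y = u then 0 else a) * g y) = a * (t - s u)"
    if u: "u \<in> {1..n}" for u a
  proof -
    have "(\<Sum>y\<in>pverts G. (if fst y = u then 0 else a) * g y) =
        (\<Sum>w\<in>{1..n}. (if w = u then 0 else a) * s w)"
      unfolding pverts_G s_def by (simp add: sum.cartesian_product sum_distrib_left split_beta)
    also have "\<dots> = (\<Sum>w\<in>{1..n}. a * s w - (if w = u then a * s w else 0))"
      by (intro sum.cong) auto
    also have "\<dots> = a * (t - s u)"
      using u by (simp add: sum_subtractf ts sum_distrib_left right_diff_distrib)
    finally show ?thesis .
  qed
  have es: "(e + 1) * s u = t" if u: "u \<in> {1..n}" for u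
  proof -
    have "e * s u = (\<Sum>i\<in>{1..r}. \<Sum>y\<in>pverts G. of_real (adj (u, i) y) * g y)"
      unfolding s_def sum_distrib_left using u by (intro sum.cong refl ev[symmetric]) (auto simp: pverts_G)
    also have "\<dots> = (\<Sum>y\<in>pverts G. of_real (\<Sum>i\<in>{1..r}. adj (u, i) y) * g y)"
      by (subst sum.swap) (simp add: sum_distrib_right)
    also have "\<dots> = (\<Sum>y\<in>pverts G. (if fst y = u then 0 else 1) * g y)"
      by (intro sum.cong refl, subst sum_fibre_adj[OF u]) auto
    also have "\<dots> = t - s u" using other_fibres[OF u, of 1] by simp
    finally show ?thesis by (simp add: algebra_simps)
  qed
  have "(e + 1) * t = (\<Sum>u\<in>{1..n}. (e + 1) * s u)" by (simp add: ts sum_distrib_left)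
  also have "\<dots> = of_nat n * t" using es by simp
  finally have "(e - (of_nat n - 1)) * t = 0" by (simp add: algebra_simps)
  with neg have t0: "t = 0" by simp
  have s0: "s u = 0" if "u \<in> {1..n}" for u
  proof -
    have "e + 1 \<noteq> 0" using neg by (simp add: eq_neg_iff_add_eq_0)
    thus ?thesis using es[OF that] t0 by simp
  qed
  obtain u i where x: "x0 = (u, i)" "u \<in> {1..n}" using x0 by (auto simp: pverts_G)
  have "e\<^sup>2 * g x0 = (\<Sum>z\<in>pverts G. of_real (adj x0 z) * (e * g z))"
    unfolding power2_eq_square mult.assoc ev[OF x0(1), symmetric] sum_distrib_left
    by (simp add: mult.left_commute)
  also have "\<dots> = (\<Sum>z\<in>pverts G. of_real (adj x0 z) * (\<Sum>y\<in>pverts G. of_real (adj z y) * g y))"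
    using ev by (intro sum.cong) auto
  also have "\<dots> = (\<Sum>y\<in>pverts G. of_real (\<Sum>z\<in>pverts G. adj x0 z * adj z y) * g y)"
    unfolding sum_distrib_left by (subst sum.swap) (simp add: sum_distrib_right mult.assoc)
  also have "\<dots> = (\<Sum>y\<in>pverts G. (if x0 = y then (of_nat n - 1) * g y else 0)
      + of_real (delta n r c) * (of_real (adj x0 y) * g y) + (if fst y = u then 0 else of_nat c) * g y)"
    by (intro sum.cong refl, subst adj_square[OF x0(1)]) (auto simp: x(1) algebra_simps)
  also have "\<dots> = (of_nat n - 1) * g x0 + of_real (delta n r c) * (e * g x0) + of_nat c * (t - s u)"
    unfolding sum.distrib sum_distrib_left[symmetric] ev[OF x0(1)] other_fibres[OF x(2)]
    using x0(1) by (simp add: pverts_G)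
  finally have "e\<^sup>2 * g x0 = ((of_nat n - 1) + of_real (delta n r c) * e) * g x0"
    using t0 s0[OF x(2)] by (simp add: algebra_simps)
  with x0(2) neg show False by simp
qed

text \<open>The cubic \<open>P\<close> with roots \<open>n - 1\<close>, \<open>-1\<close> and
  \<open>\<theta>\<close> vanishes on the spectrum except at \<open>\<tau>\<close>, so its spectral
  sum is \<open>m_tau\<close> times \<open>P \<tau>\<close>. The same sum follows from the traces of
  the first three powers, which count closed walks; thus one multiplicity is found without the
  others.\<close>

lemma m_tau_eq:
  "real (m_tau n r c f) * (theta n r c - tau n r c) = real n * (real r - 1) * theta n r c"
proof -
  define N where "N = n * r"
  define vs where "vs = List.product [1..<n+1] [1..<r+1]"
  define M where "M = adj_matrix G vs"
  define C where "C = map_mat complex_of_real M"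
  have len: "length vs = N" by (simp add: vs_def N_def)
  have bij: "bij_betw ((!) vs) {..<N} (pverts G)" unfolding vs_def N_def by (rule bij_verts)
  have M: "M \<in> carrier_mat N N" and C: "C \<in> carrier_mat N N"
    by (auto simp: M_def C_def adj_matrix_def len)
  have C_index: "C $$ (a, b) = of_real (adj (vs ! a) (vs ! b))" if "a < N" "b < N" for a b
    using that by (simp add: C_def M_def adj_matrix_def len adj_def)
  have V: "vs ! a \<in> pverts G" if "a < N" for a using bij that by (auto simp: bij_betw_def)
  have sum_V: "(\<Sum>a<N. h (vs ! a)) = (\<Sum>x\<in>pverts G. h x)" for h :: "nat \<times> nat \<Rightarrow> complex"
    by (rule sum.reindex_bij_betw[OF bij])
  have cardV: "of_nat (card (pverts G)) = (of_nat N :: complex)" by (simp add: pverts_G N_def)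
  let ?\<theta> = "theta n r c" and ?\<tau> = "tau n r c" and ?\<delta> = "delta n r c"
  have sum: "?\<theta> + ?\<tau> = ?\<delta>" by (simp add: theta_def)
  note tt = theta_tau[OF n2, of r c]
  obtain es where es: "char_poly C = (\<Prod>e\<leftarrow>es. [:- e, 1:])" "length es = N"
    "\<And>e. e \<in> set es \<Longrightarrow> eigenvalue C e" "\<And>k. mtrace (C ^\<^sub>m k) = (\<Sum>e\<leftarrow>es. e ^ k)"
    using mtrace_pow_spectrum[OF C] by metis
  have "order (complex_of_real ?\<tau>) (char_poly C) = order ?\<tau> (char_poly M)"
    unfolding C_def of_real_hom.char_poly_hom[OF M]
    using degree_monic_char_poly[OF M] by (intro order_of_real_poly) auto
  hence order: "m_tau n r c f = count_list es (of_real ?\<tau>)"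
    unfolding es(1) order_linear_factors by (simp add: m_tau_def M_def vs_def)
  have ev: "(e - (of_nat n - 1)) * (e + 1) * (e - of_real ?\<theta>) = 0"
    if e: "e \<in> set es" "e \<noteq> of_real ?\<tau>" for e
  proof -
    obtain v a where a: "a < N" "v a \<noteq> 0"
      and v: "\<And>a. a < N \<Longrightarrow> (\<Sum>b<N. C $$ (a, b) * v b) = e * v a"
      using eigenvalue_imp_eigenfunction[OF C es(3)[OF e(1)]] by metis
    \<comment> \<open>Carries the eigenvector from positions in \<open>vs\<close> over to
      vertices.\<close>
    define g where "g = (\<lambda>x. v (the_inv_into {..<N} ((!) vs) x))"
    have g: "g (vs ! b) = v b" if "b < N" for b
      using the_inv_into_f_f[OF bij_betw_imp_inj_on[OF bij]] that by (simp add: g_def)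
    have "e = of_nat n - 1 \<or> e = -1 \<or> e\<^sup>2 = (of_nat n - 1) + of_real ?\<delta> * e"
    proof (rule eigenfunction_adj)
      show "vs ! a \<in> pverts G" "g (vs ! a) \<noteq> 0" using V g a by auto
      fix x assume "x \<in> pverts G"
      then obtain b where b: "b < N" "x = vs ! b" using bij by (auto simp: bij_betw_def)
      have "(\<Sum>y\<in>pverts G. of_real (adj x y) * g y) = (\<Sum>d<N. C $$ (b, d) * v d)"
        unfolding sum_V[symmetric] using b g by (intro sum.cong) (auto simp: C_index)
      thus "(\<Sum>y\<in>pverts G. of_real (adj x y) * g y) = e * g x" using v b g by simp
    qed
    moreover have "e = of_real ?\<theta>" if q: "e\<^sup>2 = (of_nat n - 1) + of_real ?\<delta> * e"
    proof -
      have nn: "of_nat n - 1 = - (complex_of_real ?\<theta> * of_real ?\<tau>)"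
        using arg_cong[OF tt(1), of complex_of_real] by simp
      have "(e - of_real ?\<theta>) * (e - of_real ?\<tau>) = 0"
        using q unfolding nn sum[symmetric] by (simp add: power2_eq_square algebra_simps)
      thus ?thesis using e(2) by simp
    qed
    ultimately show ?thesis by auto
  qed
  have tr1: "(\<Sum>e\<leftarrow>es. e) = 0"
  proof -
    have "mtrace C = 0" using C by (simp add: mtrace_def C_index adj_def) (simp add: split_paired_all arc_cover_def Kn_def case_prod_beta)
    thus ?thesis using es(4)[of 1] C by simp
  qed
  have C2: "(C ^\<^sub>m 2) $$ (a, b) = of_real (\<Sum>z\<in>pverts G. adj (vs ! a) z * adj z (vs ! b))"
    if "a < N" "b < N" for a b
  proof -
    have "C ^\<^sub>m 2 = C * C" using C by (simp add: numeral_2_eq_2)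
    hence "(C ^\<^sub>m 2) $$ (a, b) = (\<Sum>d<N. of_real (adj (vs ! a) (vs ! d) * adj (vs ! d) (vs ! b)))"
      using mat_mult_index[OF C C that] that by (simp add: C_index)
    thus ?thesis by (simp add: sum_V[symmetric])
  qed
  have tr2: "(\<Sum>e\<leftarrow>es. e\<^sup>2) = of_nat N * (of_nat n - 1)"
  proof -
    have "mtrace (C ^\<^sub>m 2) = (\<Sum>a<N. of_real (\<Sum>z\<in>pverts G. adj (vs ! a) z * adj z (vs ! a)))"
      using C by (simp add: mtrace_def C2)
    also have "\<dots> = (\<Sum>a<N. of_nat n - 1)"
    proof (intro sum.cong refl)
      fix a assume "a \<in> {..<N}"
      hence "(\<Sum>z\<in>pverts G. adj (vs ! a) z * adj z (vs ! a)) = (\<Sum>z\<in>pverts G. adj (vs ! a) z)"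
        by (intro sum.cong refl, subst adj_commute) (simp add: adj_def)
      thus "complex_of_real (\<Sum>z\<in>pverts G. adj (vs ! a) z * adj z (vs ! a)) = of_nat n - 1"
        using degree_adj[OF V] \<open>a \<in> {..<N}\<close> by simp
    qed
    finally show ?thesis using es(4) by simp
  qed
  \<comment> \<open>Closed walks of length 3: each of the \<open>N (n - 1)\<close> arcs extends to
    \<open>\<delta> + c\<close> of them.\<close>
  have tr3: "(\<Sum>e\<leftarrow>es. e ^ 3) = of_nat N * (of_nat n - 1) * (of_real ?\<delta> + of_nat c)"
  proof -
    have "mtrace (C ^\<^sub>m 3) = mtrace (C ^\<^sub>m 2 * C)" by (simp add: eval_nat_numeral)
    also have "\<dots> = (\<Sum>a<N. \<Sum>b<N. (C ^\<^sub>m 2) $$ (a, b) * C $$ (b, a))"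
      using mat_mult_index[of "C ^\<^sub>m 2" N N C N] C by (simp add: mtrace_def)
    also have "\<dots> = (\<Sum>a<N. \<Sum>b<N. (of_real ?\<delta> + of_nat c) * of_real (adj (vs ! a) (vs ! b)))"
    proof (intro sum.cong refl)
      fix a b assume ab: "a \<in> {..<N}" "b \<in> {..<N}"
      have "vs ! a \<noteq> vs ! b \<and> fst (vs ! a) \<noteq> fst (vs ! b)" if "(vs ! a, vs ! b) \<in> parcs G"
        using that by (cases "vs ! a"; cases "vs ! b") (auto simp: arc_iff)
      moreover have "C $$ (b, a) = of_real (adj (vs ! a) (vs ! b))"
        using ab C_index adj_commute by simp
      ultimately show "(C ^\<^sub>m 2) $$ (a, b) * C $$ (b, a) =
          (of_real ?\<delta> + of_nat c) * of_real (adj (vs ! a) (vs ! b))"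
        using ab V by (cases "(vs ! a, vs ! b) \<in> parcs G") (simp_all add: C2 adj_square adj_def[of "vs ! a" "vs ! b"])
    qed
    also have "\<dots> = (\<Sum>a<N. (of_real ?\<delta> + of_nat c) * (of_nat n - 1))"
    proof (intro sum.cong refl)
      fix a assume "a \<in> {..<N}"
      hence "(\<Sum>b<N. complex_of_real (adj (vs ! a) (vs ! b))) = of_nat n - 1"
        using arg_cong[OF degree_adj[OF V], of a complex_of_real]
        by (simp add: sum_V[where h = "\<lambda>x. of_real (adj (vs ! a) x)"])
      thus "(\<Sum>b<N. (of_real ?\<delta> + of_nat c) * complex_of_real (adj (vs ! a) (vs ! b))) =
          (of_real ?\<delta> + of_nat c) * (of_nat n - 1)"
        by (simp flip: sum_distrib_left)
    qed
    finally show ?thesis using es(4) by simp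
  qed
  define P where "P = (\<lambda>e :: complex. (e - (of_nat n - 1)) * (e + 1) * (e - of_real ?\<theta>))"
  have "(\<Sum>e\<leftarrow>es. P e) = of_nat (m_tau n r c f) * P (of_real ?\<tau>)"
    using sum_list_count_split[of es "of_real ?\<tau>" P 0] ev by (simp add: P_def order)
  moreover have "(\<Sum>e\<leftarrow>es. P e) = (\<Sum>e\<leftarrow>es. e ^ 3) - (of_nat n - 2 + of_real ?\<theta>) * (\<Sum>e\<leftarrow>es. e\<^sup>2)
      + ((of_nat n - 2) * of_real ?\<theta> - (of_nat n - 1)) * (\<Sum>e\<leftarrow>es. e) + (of_nat n - 1) * of_real ?\<theta> * of_nat (length es)"
    by (induction es) (simp_all add: P_def power2_eq_square power3_eq_cube algebra_simps)
  ultimately have "of_nat (m_tau n r c f) * P (of_real ?\<tau>) =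
      of_nat N * (of_nat n - 1) * (of_real ?\<delta> + of_nat c - (of_nat n - 2))"
    unfolding tr1 tr2 tr3 es(2) by (simp add: algebra_simps)
  hence "complex_of_real (real (m_tau n r c f) * ((?\<tau> - (real n - 1)) * (?\<tau> + 1) * (?\<tau> - ?\<theta>))) =
      of_real (real N * (real n - 1) * (?\<delta> + real c - (real n - 2)))"
    by (simp add: P_def)
  hence 1: "real (m_tau n r c f) * ((?\<tau> - (real n - 1)) * (?\<tau> + 1) * (?\<tau> - ?\<theta>)) =
      real N * (real n - 1) * (?\<delta> + real c - (real n - 2))"
    by (simp only: of_real_eq_iff)
  have "(?\<tau> - (real n - 1)) * (?\<tau> + 1) = ?\<tau> * (?\<delta> - ?\<theta>) - (real n - 2) * ?\<tau> - (real n - 1)"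
    by (simp add: theta_def algebra_simps)
  also have "\<dots> = - (real r * real c * ?\<tau>)"
    using tt(1) by (simp add: delta_def algebra_simps)
  finally have 2: "(?\<tau> - (real n - 1)) * (?\<tau> + 1) = - (real r * real c * ?\<tau>)" .
  have 3: "?\<delta> + real c - (real n - 2) = - ((real r - 1) * real c)"
    by (simp add: delta_def algebra_simps)
  have 4: "real n - 1 = - (?\<theta> * ?\<tau>)" using tt(1) by simp
  \<comment> \<open>The common factor \<open>r c \<tau>\<close> is nonzero; on the right-hand side
    its \<open>\<tau>\<close> comes from \<open>n - 1 = - \<theta> \<tau>\<close>.\<close>
  have "(real r * real c * ?\<tau>) * (real (m_tau n r c f) * (?\<theta> - ?\<tau>)) =
      (real r * real c * ?\<tau>) * (real n * (real r - 1) * ?\<theta>)"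
    using 1 unfolding 2 3 unfolding 4 N_def by (simp add: algebra_simps)
  thus ?thesis using tt(3) r2 c1 by simp
qed

end

section \<open>Character matrices of abelian covers\<close>

context arc_fun
begin

abbreviation H where "H \<equiv> arc_group n r f"

lemma H_simps: "mult H = (\<circ>)" "one H = id"
  by (simp_all add: arc_group_def sym_group_def)

lemma f_in_H: "u \<in> {1..n} \<Longrightarrow> v \<in> {1..n} \<Longrightarrow> u \<noteq> v \<Longrightarrow> f u v \<in> carrier H"
  by (auto simp: arc_group_def Kn_def intro!: generate.incl)

lemma H_permutes:
  assumes "g \<in> carrier H"
  shows "g permutes {1..r}"
proof -
  note assms
  moreover have "{f u v | u v. (u, v) \<in> parcs (Kn n)} \<subseteq> carrier (sym_group r)"
    using f_arc(1) by (force simp: Kn_def simp del: sym_group_inv_equality)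
  hence "carrier H \<subseteq> carrier (sym_group r)"
    unfolding arc_group_def using group.generate_incl[OF sym_group_is_group] by simp
  ultimately show ?thesis using sym_group_carrier by blast
qed

text \<open>Freeness makes evaluation at the point 1 injective, transitivity makes it surjective.
  Group elements can therefore be counted as points of a fibre.\<close>

lemma regular_bij:
  assumes grp: "group H" and reg: "acts_regularly H r" and r: "1 \<le> r"
  shows "bij_betw (\<lambda>g. g 1) (carrier H) {1..r}"
proof -
  interpret H: group H by fact
  have one: "1 \<in> {1..r}" using r by simp
  have "inj_on (\<lambda>g. g 1) (carrier H)"
  proof (rule inj_onI)
    fix g h assume gh: "g \<in> carrier H" "h \<in> carrier H" "g 1 = h 1"
    define k where "k = inv\<^bsub>H\<^esub> h \<otimes>\<^bsub>H\<^esub> g"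
    have k: "k \<in> carrier H" using gh by (simp add: k_def)
    have "(inv\<^bsub>H\<^esub> h) \<circ> h = id" using H.l_inv[OF gh(2)] by (simp add: H_simps)
    hence "k 1 = 1" using gh(3) by (metis H_simps(1) comp_apply id_apply k_def)
    hence "k = \<one>\<^bsub>H\<^esub>" using reg k one unfolding acts_regularly_def by blast
    thus "g = h" using gh unfolding k_def by (metis H.inv_closed H.inv_equality H.inv_inv)
  qed
  moreover have "(\<lambda>g. g 1) ` carrier H = {1..r}"
  proof
    show "(\<lambda>g. g 1) ` carrier H \<subseteq> {1..r}"
      using permutes_in_image[OF H_permutes] one by blast
    show "{1..r} \<subseteq> (\<lambda>g. g 1) ` carrier H"
    proof
      fix j assume "j \<in> {1..r}"
      then obtain g where "g \<in> carrier H" "g 1 = j"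
        using reg one unfolding acts_regularly_def by blast
      thus "j \<in> (\<lambda>g. g 1) ` carrier H" by (intro image_eqI) auto
    qed
  qed
  ultimately show ?thesis by (simp add: bij_betw_def)
qed

text \<open>\<open>Suc\<close> translates matrix indices, which start at 0, into fibres, which start
  at 1.\<close>

definition char_mat :: "((nat \<Rightarrow> nat) \<Rightarrow> complex) \<Rightarrow> complex mat" where
  "char_mat \<phi> = mat n n (\<lambda>(a, b). if a = b then 0 else \<phi> (f (Suc a) (Suc b)))"

lemma char_mat_carrier: "char_mat \<phi> \<in> carrier_mat n n"
  by (simp add: char_mat_def)

lemma char_mat_index:
  "a < n \<Longrightarrow> b < n \<Longrightarrow> char_mat \<phi> $$ (a, b) = (if a = b then 0 else \<phi> (f (Suc a) (Suc b)))"
  by (simp add: char_mat_def)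

text \<open>Off the diagonal an entry of the square sums over two-step walks \<open>u, w, v\<close>;
  on the diagonal every walk \<open>u, w, u\<close> contributes 1. The coefficient \<open>q\<close>
  is left open: it is \<open>\<delta>\<close> for a nontrivial character and \<open>n - 2\<close>
  for the trivial one.\<close>

lemma char_mat_square:
  assumes q: "\<And>u v. u \<in> {1..n} \<Longrightarrow> v \<in> {1..n} \<Longrightarrow> u \<noteq> v \<Longrightarrow>
      (\<Sum>w\<in>{1..n} - {u, v}. \<phi> (f u w) * \<phi> (f w v)) = q * \<phi> (f u v)"
    and inv: "\<And>u w. u \<in> {1..n} \<Longrightarrow> w \<in> {1..n} \<Longrightarrow> u \<noteq> w \<Longrightarrow> \<phi> (f u w) * \<phi> (f w u) = 1"
  shows "char_mat \<phi> * char_mat \<phi> = (of_nat n - 1) \<cdot>\<^sub>m 1\<^sub>m n + q \<cdot>\<^sub>m char_mat \<phi>"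
proof (rule eq_matI)
  fix a b assume "a < dim_row ((of_nat n - 1) \<cdot>\<^sub>m 1\<^sub>m n + q \<cdot>\<^sub>m char_mat \<phi>)"
    "b < dim_col ((of_nat n - 1) \<cdot>\<^sub>m 1\<^sub>m n + q \<cdot>\<^sub>m char_mat \<phi>)"
  hence ab: "a < n" "b < n" by (auto simp: char_mat_def)
  have "(char_mat \<phi> * char_mat \<phi>) $$ (a, b) = (\<Sum>l<n. char_mat \<phi> $$ (a, l) * char_mat \<phi> $$ (l, b))"
    by (rule mat_mult_index[OF char_mat_carrier char_mat_carrier ab])
  also have "\<dots> = (\<Sum>l\<in>{..<n} - {a, b}. \<phi> (f (Suc a) (Suc l)) * \<phi> (f (Suc l) (Suc b)))"
    by (rule sum.mono_neutral_cong_right) (use ab in \<open>auto simp: char_mat_index\<close>)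
  also have "\<dots> = (\<Sum>w\<in>{1..n} - {Suc a, Suc b}. \<phi> (f (Suc a) w) * \<phi> (f w (Suc b)))"
    by (rule sum.reindex_bij_witness[of _ "\<lambda>w. w - 1" Suc]) (use ab in auto)
  also have "\<dots> = ((of_nat n - 1) \<cdot>\<^sub>m 1\<^sub>m n + q \<cdot>\<^sub>m char_mat \<phi>) $$ (a, b)"
  proof (cases "a = b")
    case True
    have "(\<Sum>w\<in>{1..n} - {Suc a, Suc b}. \<phi> (f (Suc a) w) * \<phi> (f w (Suc b))) = (\<Sum>w\<in>{1..n} - {Suc a}. 1)"
      using ab True inv by (intro sum.cong) auto
    thus ?thesis using ab True by (simp add: char_mat_def of_nat_diff)
  next
    case False
    thus ?thesis using ab q[of "Suc a" "Suc b"] by (simp add: char_mat_def)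
  qed
  finally show "(char_mat \<phi> * char_mat \<phi>) $$ (a, b) =
      ((of_nat n - 1) \<cdot>\<^sub>m 1\<^sub>m n + q \<cdot>\<^sub>m char_mat \<phi>) $$ (a, b)" .
qed (auto simp: char_mat_def)

end

section \<open>Walk sums of characters and the resulting parameters\<close>

context uniform_arc_fun
begin

text \<open>Two-step walks from \<open>u\<close> to \<open>v\<close> are grouped by the group
  element they induce. If every element is credited with \<open>c\<close> walks, only
  \<open>f u v\<close> deviates, by \<open>\<delta>\<close>; the uniform part cancels since a
  nontrivial character sums to zero.\<close>

lemma character_walk_sum:
  assumes grp: "group H" and reg: "acts_regularly H r"
    and hom: "\<And>g h. g \<in> carrier H \<Longrightarrow> h \<in> carrier H \<Longrightarrow> \<phi> (g \<otimes>\<^bsub>H\<^esub> h) = \<phi> g * (\<phi> h :: complex)"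
    and nontriv: "g0 \<in> carrier H" "\<phi> g0 \<noteq> 1"
    and u: "u \<in> {1..n}" and v: "v \<in> {1..n}" and uv: "u \<noteq> v"
  shows "(\<Sum>w\<in>{1..n} - {u, v}. \<phi> (f u w) * \<phi> (f w v)) = of_real (delta n r c) * \<phi> (f u v)"
proof -
  interpret H: group H by fact
  have bij: "bij_betw (\<lambda>g. g 1) (carrier H) {1..r}" using regular_bij[OF grp reg] r2 by simp
  hence fin: "finite (carrier H)" by (simp add: bij_betw_finite)
  have one: "1 \<in> {1..r}" using r2 by simp
  let ?W = "{1..n} - {u, v}" and ?g = "\<lambda>w. f w v \<circ> f u w"
  have gH: "?g w \<in> carrier H" if "w \<in> ?W" for w
    using H.m_closed[OF f_in_H[of w v] f_in_H[of u w]] u v that by (simp add: H_simps)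
  have "(\<Sum>w\<in>?W. \<phi> (f u w) * \<phi> (f w v)) = (\<Sum>w\<in>?W. \<phi> (?g w))"
  proof (intro sum.cong refl)
    fix w assume "w \<in> ?W"
    thus "\<phi> (f u w) * \<phi> (f w v) = \<phi> (?g w)"
      using hom[OF f_in_H[of w v] f_in_H[of u w]] u v by (simp add: H_simps mult.commute)
  qed
  also have "\<dots> = (\<Sum>g\<in>carrier H. \<Sum>w\<in>{w \<in> ?W. ?g w = g}. \<phi> (?g w))"
    by (rule sum.group[symmetric]) (use gH fin in blast)+
  also have "\<dots> = (\<Sum>g\<in>carrier H. of_nat c * \<phi> g + (if g = f u v then of_real (delta n r c) * \<phi> g else 0))"
  proof (intro sum.cong refl)
    fix g assume g: "g \<in> carrier H"
    \<comment> \<open>By regularity an element is determined by the image of point 1, so the walks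
      inducing \<open>g\<close> correspond to the common neighbours of \<open>(u, 1)\<close> and
      \<open>(v, g 1)\<close>.\<close>
    have "?g w = g \<longleftrightarrow> f w v (f u w 1) = g 1" if "w \<in> ?W" for w
      using inj_onD[OF bij_betw_imp_inj_on[OF bij] _ gH[OF that] g] by auto
    hence eq: "{w \<in> ?W. ?g w = g} = common_nbrs n f u 1 v (g 1)"
      unfolding common_nbrs_def by blast
    have "(\<Sum>w\<in>{w \<in> ?W. ?g w = g}. \<phi> (?g w)) = (\<Sum>w\<in>{w \<in> ?W. ?g w = g}. \<phi> g)"
      by (intro sum.cong) auto
    also have "\<dots> = of_nat (card (common_nbrs n f u 1 v (g 1))) * \<phi> g"
      unfolding eq by simp
    also have "\<dots> = of_nat c * \<phi> g + (if g = f u v then of_real (delta n r c) * \<phi> g else 0)"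
    proof (cases "g = f u v")
      case True
      have "real (card (common_nbrs n f u 1 v (g 1))) + (real r - 1) * real c = real n - 2"
        using arg_cong[OF card_common_adjacent[OF u v one uv], of real] True n2 r2
        by (simp add: of_nat_diff)
      hence "real (card (common_nbrs n f u 1 v (g 1))) = real c + delta n r c"
        by (simp add: delta_def algebra_simps)
      hence "complex_of_nat (card (common_nbrs n f u 1 v (g 1))) = of_nat c + of_real (delta n r c)"
        by (metis of_real_add of_real_of_nat_eq)
      thus ?thesis using True by (simp add: algebra_simps)
    next
      case False
      hence "f u v 1 \<noteq> g 1"
        using inj_onD[OF bij_betw_imp_inj_on[OF bij] _ g f_in_H[OF u v uv]] by auto
      moreover have "g 1 \<in> {1..r}" using bij g by (auto simp: bij_betw_def)
      ultimately show ?thesis using card_common[OF u v one _ uv] False by simp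
    qed
    finally show "(\<Sum>w\<in>{w \<in> ?W. ?g w = g}. \<phi> (?g w)) =
        of_nat c * \<phi> g + (if g = f u v then of_real (delta n r c) * \<phi> g else 0)" .
  qed
  also have "\<dots> = of_nat c * (\<Sum>g\<in>carrier H. \<phi> g) + of_real (delta n r c) * \<phi> (f u v)"
    using fin f_in_H[OF u v uv] by (simp add: sum.distrib sum_distrib_left)
  also have "(\<Sum>g\<in>carrier H. \<phi> g) = 0"
    by (rule H.sum_character[OF hom nontriv])
  finally show ?thesis by simp
qed

lemma abelian_maximal_parameters:
  assumes cg: "comm_group H" and reg: "acts_regularly H r"
    and max: "real n = (m_tau_bar n r c f)\<^sup>2"
  shows "(n, r, c) = (9, 3, 3)"
proof -
  interpret H: comm_group H by fact
  have grp: "group H" by (rule H.group_axioms)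
  have bij: "bij_betw (\<lambda>g. g 1) (carrier H) {1..r}" using regular_bij[OF grp reg] r2 by simp
  hence fin: "finite (carrier H)" and card: "card (carrier H) = r"
    using bij_betw_same_card[OF bij] by (simp_all add: bij_betw_finite)
  have "carrier H \<noteq> {\<one>\<^bsub>H\<^esub>}" using card r2 by auto
  then obtain \<phi> :: "(nat \<Rightarrow> nat) \<Rightarrow> complex" and g0 where g0: "g0 \<in> carrier H" "\<phi> g0 \<noteq> 1"
    and \<phi>1: "\<phi> \<one>\<^bsub>H\<^esub> = 1"
    and hom: "\<And>g h. g \<in> carrier H \<Longrightarrow> h \<in> carrier H \<Longrightarrow> \<phi> (g \<otimes>\<^bsub>H\<^esub> h) = \<phi> g * \<phi> h"
    using H.ex_nontrivial_character[OF fin] by metis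
  have inv: "\<phi> (f u w) * \<phi> (f w u) = 1" if "u \<in> {1..n}" "w \<in> {1..n}" "u \<noteq> w" for u w
  proof -
    have "f u w \<circ> f w u = id" using f_inv[of w u] that by (auto simp: fun_eq_iff)
    thus ?thesis using hom[OF f_in_H[OF that] f_in_H[OF that(2,1)]] that(3) \<phi>1 by (simp add: H_simps)
  qed
  define \<psi> where "\<psi> = (\<lambda>g. (\<phi> g)\<^sup>2)"
  let ?\<theta> = "theta n r c" and ?\<tau> = "tau n r c" and ?\<delta> = "delta n r c"
  let ?S = "char_mat \<phi>" and ?T = "char_mat \<psi>"
  note tt = theta_tau[OF n2, of r c]
  have sum: "?\<theta> + ?\<tau> = ?\<delta>" by (simp add: theta_def)
  have S: "?S * ?S = (of_nat n - 1) \<cdot>\<^sub>m 1\<^sub>m n + of_real ?\<delta> \<cdot>\<^sub>m ?S"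
    by (rule char_mat_square[OF character_walk_sum[OF grp reg hom g0] inv])
  have nn: "complex_of_nat n - 1 = - of_real ?\<theta> * of_real ?\<tau>"
    using arg_cong[OF tt(1), of complex_of_real] by simp
  have S': "?S * ?S = (- of_real ?\<theta> * of_real ?\<tau>) \<cdot>\<^sub>m 1\<^sub>m n + (of_real ?\<theta> + of_real ?\<tau>) \<cdot>\<^sub>m ?S"
    unfolding S nn sum[symmetric] by simp
  have inv\<psi>: "\<psi> (f u w) * \<psi> (f w u) = 1" if "u \<in> {1..n}" "w \<in> {1..n}" "u \<noteq> w" for u w
    using inv[OF that] by (simp add: \<psi>_def flip: power_mult_distrib)
  have hom\<psi>: "\<psi> (g \<otimes>\<^bsub>H\<^esub> h) = \<psi> g * \<psi> h" if "g \<in> carrier H" "h \<in> carrier H" for g h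
    using hom[OF that] by (simp add: \<psi>_def power_mult_distrib)
  \<comment> \<open>The two cases for \<open>\<psi>\<close> lead to an equation of the same shape,
    so they can be treated together until \<open>q\<close> is known.\<close>
  have "\<exists>q. (q = ?\<delta> \<or> q = real n - 2) \<and>
      ?T * ?T = (of_nat n - 1) \<cdot>\<^sub>m 1\<^sub>m n + of_real q \<cdot>\<^sub>m ?T"
  proof (cases "\<exists>g\<in>carrier H. \<psi> g \<noteq> 1")
    case True
    then obtain g where g: "g \<in> carrier H" "\<psi> g \<noteq> 1" by blast
    have "?T * ?T = (of_nat n - 1) \<cdot>\<^sub>m 1\<^sub>m n + of_real ?\<delta> \<cdot>\<^sub>m ?T"
      by (rule char_mat_square[OF character_walk_sum[where \<phi> = \<psi>, OF grp reg hom\<psi> g] inv\<psi>])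
    thus ?thesis by blast
  next
    case False
    have J: "(\<Sum>w\<in>{1..n} - {u, v}. \<psi> (f u w) * \<psi> (f w v)) = of_real (real n - 2) * \<psi> (f u v)"
      if uv: "u \<in> {1..n}" "v \<in> {1..n}" "u \<noteq> v" for u v
    proof -
      have "(\<Sum>w\<in>{1..n} - {u, v}. \<psi> (f u w) * \<psi> (f w v)) = (\<Sum>w\<in>{1..n} - {u, v}. 1)"
        using False uv f_in_H by (intro sum.cong refl) auto
      also have "\<dots> = of_nat (n - 2)" using uv by (simp add: card_Diff_subset)
      finally show ?thesis using False uv f_in_H n2 by (simp add: of_nat_diff)
    qed
    have "?T * ?T = (of_nat n - 1) \<cdot>\<^sub>m 1\<^sub>m n + of_real (real n - 2) \<cdot>\<^sub>m ?T"
      by (rule char_mat_square[OF J inv\<psi>])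
    thus ?thesis by blast
  qed
  then obtain q where q: "q = ?\<delta> \<or> q = real n - 2"
    and T: "?T * ?T = (of_nat n - 1) \<cdot>\<^sub>m 1\<^sub>m n + of_real q \<cdot>\<^sub>m ?T" by blast
  obtain d where d: "of_nat n * complex_of_real ?\<theta> = of_nat d * (of_real ?\<theta> - of_real ?\<tau>)"
    and eig: "d * (d + 1) < 2 * n \<Longrightarrow> eigenvalue ?T (- (of_real ?\<theta>)\<^sup>2)"
  proof (rule hadamard_square_eigenvalue[OF char_mat_carrier _ S' _ char_mat_carrier])
    show "complex_of_real ?\<theta> \<noteq> of_real ?\<tau>" using tt by simp
  qed (auto simp: char_mat_index \<psi>_def)
  have "complex_of_real (real n * ?\<theta>) = of_real (real d * (?\<theta> - ?\<tau>))" using d by simp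
  hence d_theta: "real n * ?\<theta> = real d * (?\<theta> - ?\<tau>)" by (simp only: of_real_eq_iff)
  \<comment> \<open>The equation for the multiplicity of \<open>\<tau>\<close>, divided by
    \<open>r - 1\<close>, is the one satisfied by \<open>d\<close>.\<close>
  have "m_tau_bar n r c f * (?\<theta> - ?\<tau>) = real n * ?\<theta>"
    using m_tau_eq r2 by (simp add: m_tau_bar_def divide_simps mult_ac)
  hence "m_tau_bar n r c f = real d" using d_theta tt by simp
  hence n: "real n = (real d)\<^sup>2" using max by simp
  hence nd: "n = d * d" by (simp add: power2_eq_square flip: of_nat_mult)
  have d2: "2 \<le> d" using n2 unfolding nd by (cases "d = 0 \<or> d = 1") auto
  have "real d * ?\<theta> = ?\<theta> - ?\<tau>"
    using d_theta d2 by (simp add: n power2_eq_square)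
  hence tau: "?\<tau> = ?\<theta> - real d * ?\<theta>" by simp
  have "(real d - 1) * ?\<theta>\<^sup>2 = (real d - 1) * (real d + 1)"
    using tt(1) unfolding tau n by (simp add: power2_eq_square algebra_simps)
  hence theta2: "?\<theta>\<^sup>2 = real d + 1" using d2 by simp
  \<comment> \<open>With \<open>n = d * d\<close> this amounts to \<open>d < d * d\<close>, hence
    follows from \<open>2 \<le> d\<close>.\<close>
  have "d * (d + 1) < 2 * n" using d2 unfolding nd by (simp add: algebra_simps)
  from eigenvalue_quadratic[OF char_mat_carrier T eig[OF this]]
  have "complex_of_real ((?\<theta>\<^sup>2)\<^sup>2) = of_real (real n - 1 - q * ?\<theta>\<^sup>2)" by simp
  hence "(?\<theta>\<^sup>2)\<^sup>2 = real n - 1 - q * ?\<theta>\<^sup>2" by (simp only: of_real_eq_iff)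
  hence "(real d + 1) * (real d + 1) = (real d + 1) * (real d - 1 - q)"
    unfolding theta2 n by (simp add: power2_eq_square algebra_simps)
  hence q2: "q = -2" by simp
  \<comment> \<open>\<open>q = n - 2\<close> would mean \<open>n = 0\<close>.\<close>
  hence "?\<delta> = -2" using q n2 by auto
  hence "(2 - real d) * ?\<theta> = -2" using sum tau by (simp add: algebra_simps)
  \<comment> \<open>Squaring replaces \<open>\<theta>\<close> by
    \<open>\<theta>\<^sup>2 = d + 1\<close> and leaves a cubic equation for the integer
    \<open>d\<close>.\<close>
  hence "((2 - real d) * ?\<theta>)\<^sup>2 = 4" by simp
  hence *: "(2 - real d)\<^sup>2 * (real d + 1) = 4" by (simp add: power_mult_distrib theta2)
  have "d < 4"
  proof (rule ccontr)
    assume "\<not> d < 4"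
    hence "2 * 2 * 5 \<le> (real d - 2) * (real d - 2) * (real d + 1)"
      by (intro mult_mono) auto
    also have "(real d - 2) * (real d - 2) = (2 - real d)\<^sup>2"
      by (simp add: power2_eq_square algebra_simps)
    finally show False using * by simp
  qed
  with d2 * have d3: "d = 3" by (cases "d = 2") auto
  hence n9: "n = 9" using nd by simp
  have "real (r * c) = 9" using \<open>?\<delta> = -2\<close> by (simp add: delta_def n9)
  hence rc: "r * c = 9" by linarith
  have "r * c - c \<le> 7" using parameter_bound by (simp add: n9 diff_mult_distrib)
  with rc have "2 \<le> c" by simp
  moreover have "c * 2 \<le> 9" using rc r2 mult_le_mono2[of 2 r c] by (simp add: mult.commute)
  ultimately have "c = 2 \<or> c = 3 \<or> c = 4" by linarith
  with rc have "c = 3 \<and> r = 3" by (elim disjE) (simp; presburger)+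
  with n9 show ?thesis by simp
qed

end

section \<open>The symplectic cover with parameters (9, 3, 3)\<close>

text \<open>The centre 1 will be the zero vector of the symplectic space. It is orthogonal to every
  vector, so the arc function is trivial on this spanning tree.\<close>

definition star :: "nat \<Rightarrow> nat pair_pre_digraph" where
  "star n = \<lparr> pverts = {1..n}, parcs = {(u, v). u \<in> {1..n} \<and> v \<in> {1..n} \<and> u \<noteq> v \<and> (u = 1 \<or> v = 1)} \<rparr>"

lemma pair_graph_star: "pair_graph (star n)"
proof
  show "finite (parcs (star n))"
    by (rule finite_subset[of _ "{1..n} \<times> {1..n}"]) (auto simp: star_def)
  show "Digraph.symmetric (with_proj (star n))"
    by (auto simp: Digraph.symmetric_def star_def intro!: symI)
qed (auto simp: star_def)

lemma pair_graph_Kn: "pair_graph (Kn n)"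
proof
  show "finite (parcs (Kn n))"
    by (rule finite_subset[of _ "{1..n} \<times> {1..n}"]) (auto simp: Kn_def)
  show "Digraph.symmetric (with_proj (Kn n))"
    by (auto simp: Digraph.symmetric_def Kn_def intro!: symI)
qed (auto simp: Kn_def)

text \<open>A walk in a star visits the centre at every other step.\<close>
lemma no_cycle_star:
  assumes cyc: "pre_digraph.cycle (with_proj (star n)) p" and len: "length p \<ge> 3"
  shows False
proof -
  interpret pair_graph "star n" by (rule pair_graph_star)
  obtain u where walk: "awalk u p u" and dist: "distinct (tl (pawalk_verts u p))"
    using cyc unfolding cycle_def by auto
  obtain e1 e2 e3 q where p: "p = e1 # e2 # e3 # q"
    using len by (metis Suc_le_length_iff numeral_3_eq_3)
  have arcs: "set p \<subseteq> parcs (star n)" and cas: "pcas u p u"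
    using walk by (auto simp: awalk_def)
  obtain a b c where e: "e1 = (u, a)" "e2 = (a, b)" "e3 = (b, c)" and q: "pcas c q u"
    using cas unfolding p by (cases e1; cases e2; cases e3) auto
  have adj: "u \<noteq> a \<and> (u = 1 \<or> a = 1)" "a \<noteq> b \<and> (a = 1 \<or> b = 1)" "b \<noteq> c \<and> (b = 1 \<or> c = 1)"
    using arcs unfolding p e by (auto simp: star_def)
  have verts: "tl (pawalk_verts u p) = a # b # pawalk_verts c q"
    unfolding p e by simp
  have "u \<in> set (pawalk_verts c q)"
    using q by (induction q arbitrary: c) auto
  moreover have "c \<in> set (pawalk_verts c q)" using q by (cases q) auto
  \<comment> \<open>Of the consecutive vertices \<open>u, a, b, c\<close> either \<open>a\<close> or
    \<open>b\<close> is the centre; then so is \<open>c\<close> or \<open>u\<close>, respectively,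
    against distinctness.\<close>
  ultimately have "a \<noteq> c" "b \<noteq> u" using dist unfolding verts by auto
  with adj show False by auto
qed

lemma normalizedI:
  assumes "1 \<le> n" "\<And>v. v \<in> {1..n} \<Longrightarrow> v \<noteq> 1 \<Longrightarrow> f 1 v = id \<and> f v 1 = id"
  shows "normalized n r f"
proof -
  have "(x, y) \<in> (parcs (star n))\<^sup>*" if "x \<in> {1..n}" "y \<in> {1..n}" for x y
  proof -
    have "(x, 1) \<in> (parcs (star n))\<^sup>*"
      using that assms(1) by (cases "x = 1") (auto simp: star_def)
    also have "(1, y) \<in> (parcs (star n))\<^sup>*"
      using that assms(1) by (cases "y = 1") (auto simp: star_def)
    finally show ?thesis .
  qed
  hence "Digraph_Component.connected (with_proj (star n))"
    unfolding connected_pair_graph_iff[OF pair_graph_star] using assms(1) by (auto simp: star_def)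
  moreover have "spanning (with_proj (star n)) (with_proj (Kn n))"
  proof -
    interpret S: pair_graph "star n" by (rule pair_graph_star)
    interpret K: pair_graph "Kn n" by (rule pair_graph_Kn)
    show ?thesis
      unfolding spanning_def subgraph_def
      using S.wf_digraph_axioms K.wf_digraph_axioms by (auto simp: star_def Kn_def)
  qed
  ultimately have "spanning_tree_of (star n) (Kn n)"
    unfolding spanning_tree_of_def using pair_graph_star no_cycle_star by blast
  moreover have "\<forall>(u, v) \<in> parcs (star n). f u v = \<one>\<^bsub>sym_group r\<^esub>"
    using assms(2) by (auto simp: star_def sym_group_def)
  ultimately show ?thesis unfolding normalized_def by blast
qed

text \<open>The \<open>k\<close>-th power of a 3-cycle. Points outside \<open>{1..3}\<close> are
  fixed because elements of \<open>sym_group 3\<close> are permutations of all natural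
  numbers.\<close>

definition rot3 :: "nat \<Rightarrow> nat \<Rightarrow> nat" where
  "rot3 k i = (if i \<in> {1..3} then (i - 1 + k) mod 3 + 1 else i)"

text \<open>The standard symplectic form on \<open>\<int>\<^sub>3 \<times> \<int>\<^sub>3\<close>, whose points are numbered from 1 to 9;
  the coefficient 2 stands for \<open>-1\<close>.\<close>
definition symplectic3 :: "nat \<Rightarrow> nat \<Rightarrow> nat" where
  "symplectic3 u v =
    (((u - 1) mod 3) * ((v - 1) div 3) + 2 * (((u - 1) div 3) * ((v - 1) mod 3))) mod 3"

definition f933 :: "nat \<Rightarrow> nat \<Rightarrow> nat \<Rightarrow> nat" where
  "f933 u v = rot3 (symplectic3 u v)"

lemma rot3_comp: "rot3 k \<circ> rot3 l = rot3 (k + l)"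
proof
  fix i
  have "(i - 1 + l) mod 3 < 3" by simp
  moreover have "((i - 1 + l) mod 3 + k) mod 3 = (i - 1 + (k + l)) mod 3"
    by (simp add: mod_simps ac_simps)
  ultimately show "(rot3 k \<circ> rot3 l) i = rot3 (k + l) i"
    by (auto simp: rot3_def Suc_le_eq)
qed

lemma rot3_id:
  assumes "k mod 3 = 0"
  shows "rot3 k = id"
proof
  fix i
  have "(l + k) mod 3 = l" if "l < 3" for l
    using assms that by presburger
  from this[of "i - 1"] show "rot3 k i = id i" by (auto simp: rot3_def)
qed

lemma rot3_inverse: "rot3 k \<circ> rot3 (2 * k) = id" "rot3 (2 * k) \<circ> rot3 k = id"
  unfolding rot3_comp by (rule rot3_id, simp)+

lemma rot3_carrier: "rot3 k \<in> carrier (sym_group 3)"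
proof -
  have "bij (rot3 k)" using rot3_inverse by (metis o_bij)
  moreover have "rot3 k i = i" if "i \<notin> {1..3}" for i by (simp only: rot3_def that if_False)
  ultimately show ?thesis by (simp add: sym_group_carrier permutes_bij_def permutes_def bij_iff)
qed

lemma symplectic3_skew: "(symplectic3 u v + symplectic3 v u) mod 3 = 0"
proof -
  have "((x + 2 * y) mod 3 + (y + 2 * x) mod 3) mod 3 = 0" for x y :: nat by presburger
  from this[of "((u - 1) mod 3) * ((v - 1) div 3)" "((u - 1) div 3) * ((v - 1) mod 3)"]
  show ?thesis
    unfolding symplectic3_def mult.commute[of "(v - 1) mod 3"] mult.commute[of "(v - 1) div 3"] .
qed

text \<open>Writing \<open>B\<close> for the form, the sum at \<open>w\<close> is
  \<open>B(u - v, w)\<close>, a nonzero linear functional, which takes each value at 3 of the 9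
  points. Its value at \<open>w = u\<close> and at \<open>w = v\<close> is \<open>B(u, v)\<close>,
  so for any other \<open>k\<close> the exclusion of these two points loses nothing. The proof is by
  evaluation.\<close>

lemma symplectic3_count:
  "\<forall>u\<in>set [1..<10]. \<forall>v\<in>set [1..<10]. u \<noteq> v \<longrightarrow> (\<forall>k\<in>set [0..<3]. k \<noteq> symplectic3 u v \<longrightarrow>
    length (filter (\<lambda>w. w \<noteq> u \<and> w \<noteq> v \<and> (symplectic3 u w + symplectic3 w v) mod 3 = k) [1..<10]) = 3)"
  by code_simp

lemma f933_inverse: "f933 v u \<circ> f933 u v = id"
  unfolding f933_def rot3_comp by (rule rot3_id[OF symplectic3_skew])

lemma arc_function_f933: "arc_function n 3 f933"
  unfolding arc_function_def
proof (clarify, rule conjI)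
  fix u v
  show "f933 u v \<in> carrier (sym_group 3)" unfolding f933_def by (rule rot3_carrier)
  show "f933 v u = inv\<^bsub>sym_group 3\<^esub> (f933 u v)"
    by (rule group.inv_equality[OF sym_group_is_group, symmetric])
      (simp_all add: sym_group_mult sym_group_one f933_inverse, simp_all add: f933_def rot3_carrier)
qed

text \<open>Adding 3 keeps the subtraction of natural numbers from truncating.\<close>

lemma rot3_apply_eq_iff:
  assumes "i \<in> {1..3}" "j \<in> {1..3}"
  shows "rot3 k i = j \<longleftrightarrow> k mod 3 = (j + 3 - i) mod 3"
proof -
  have "i \<in> {1, 2, 3}" "j \<in> {1, 2, 3}" using assms by auto
  thus ?thesis unfolding rot3_def by (elim insertE emptyE; simp; presburger)
qed

lemma uniform_f933: "uniform_arc_function 9 3 3 f933"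
  unfolding uniform_arc_function_def
proof (intro ballI impI)
  fix u v i j :: nat
  assume u: "u \<in> {1..9}" and v: "v \<in> {1..9}" and ij: "i \<in> {1..3}" "j \<in> {1..3}"
    and uv: "u \<noteq> v" and ne: "f933 u v i \<noteq> j"
  define k where "k = (j + 3 - i) mod 3"
  have sm: "symplectic3 u v mod 3 = symplectic3 u v" by (simp add: symplectic3_def)
  have k: "k \<in> set [0..<3]" "k \<noteq> symplectic3 u v"
    using ne sm unfolding f933_def rot3_apply_eq_iff[OF ij] k_def by auto
  have "common_nbrs 9 f933 u i v j =
      set (filter (\<lambda>w. w \<noteq> u \<and> w \<noteq> v \<and> (symplectic3 u w + symplectic3 w v) mod 3 = k) [1..<10])"
  proof -
    have "f933 w v (f933 u w i) = j \<longleftrightarrow> (symplectic3 u w + symplectic3 w v) mod 3 = k" for w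
    proof -
      have "f933 w v (f933 u w i) = rot3 (symplectic3 w v + symplectic3 u w) i"
        unfolding f933_def rot3_comp[symmetric] by simp
      thus ?thesis by (simp only: rot3_apply_eq_iff[OF ij] k_def add.commute)
    qed
    thus ?thesis unfolding common_nbrs_def by auto
  qed
  hence "card (common_nbrs 9 f933 u i v j) =
      length (filter (\<lambda>w. w \<noteq> u \<and> w \<noteq> v \<and> (symplectic3 u w + symplectic3 w v) mod 3 = k) [1..<10])"
    by (simp only: distinct_card distinct_filter distinct_upt)
  also have "\<dots> = 3"
    using symplectic3_count[rule_format, of u v k] u v uv k by simp
  finally show "card (common_nbrs 9 f933 u i v j) = 3" .
qed

lemma arc_group_f933:
  "comm_group (arc_group 9 3 f933)" "acts_regularly (arc_group 9 3 f933) 3"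
proof -
  let ?A = "{f933 u v | u v. (u, v) \<in> parcs (Kn 9)}"
  interpret S: group "sym_group 3" by (rule sym_group_is_group)
  have A: "?A \<subseteq> range rot3" by (auto simp: f933_def)
  have "subgroup (range rot3) (sym_group 3)"
  proof (rule S.subgroupI)
    show "range rot3 \<subseteq> carrier (sym_group 3)" using rot3_carrier by blast
    fix g h assume "g \<in> range rot3"
    then obtain k where k: "g = rot3 k" by blast
    have "inv\<^bsub>sym_group 3\<^esub> g = rot3 (2 * k)"
      unfolding k by (rule S.inv_equality)
        (simp_all add: sym_group_mult sym_group_one rot3_inverse rot3_carrier)
    thus "inv\<^bsub>sym_group 3\<^esub> g \<in> range rot3" by simp
    assume "h \<in> range rot3"
    thus "g \<otimes>\<^bsub>sym_group 3\<^esub> h \<in> range rot3"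
      unfolding k by (auto simp: sym_group_mult rot3_comp)
  qed simp
  hence sub: "generate (sym_group 3) ?A \<subseteq> range rot3" by (rule S.generate_subgroup_incl[OF A])
  have "range rot3 \<subseteq> carrier (sym_group 3)" using rot3_carrier by (rule image_subsetI)
  with A have "?A \<subseteq> carrier (sym_group 3)" by (rule order_trans)
  hence "subgroup (generate (sym_group 3) ?A) (sym_group 3)" by (rule S.generate_is_subgroup)
  hence "group (arc_group 9 3 f933)" unfolding arc_group_def by (rule S.subgroup_imp_group)
  thus "comm_group (arc_group 9 3 f933)"
  proof (rule group.group_comm_groupI)
    fix g h assume "g \<in> carrier (arc_group 9 3 f933)" "h \<in> carrier (arc_group 9 3 f933)"
    hence "g \<in> range rot3" "h \<in> range rot3" using sub by (auto simp: arc_group_def)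
    thus "g \<otimes>\<^bsub>arc_group 9 3 f933\<^esub> h = h \<otimes>\<^bsub>arc_group 9 3 f933\<^esub> g"
      by (auto simp: arc_group_def sym_group_mult rot3_comp add.commute)
  qed
  show "acts_regularly (arc_group 9 3 f933) 3"
    unfolding acts_regularly_def
  proof (intro conjI ballI impI)
    fix i j :: nat assume ij: "i \<in> {1..3}" "j \<in> {1..3}"
    define k where "k = (j + 3 - i) mod 3"
    have "k < 3" by (simp add: k_def)
    hence "k = 0 \<or> k = 1 \<or> k = 2" by linarith
    \<comment> \<open>Point 2 is the vector \<open>(1, 0)\<close> and point \<open>3 * k + 1\<close>
      is \<open>(0, k)\<close>. Their symplectic product is \<open>k\<close>, so every rotation is a
      value of the arc function.\<close>
    hence "f933 2 (3 * k + 1) = rot3 k" "(2, 3 * k + 1) \<in> parcs (Kn 9)"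
      by (auto simp: f933_def symplectic3_def Kn_def)
    hence "rot3 k \<in> ?A" by force
    hence "rot3 k \<in> carrier (arc_group 9 3 f933)"
      unfolding arc_group_def by (simp add: generate.incl)
    moreover have "rot3 k i = j" unfolding rot3_apply_eq_iff[OF ij] k_def by simp
    ultimately show "\<exists>g\<in>carrier (arc_group 9 3 f933). g i = j" by blast
  next
    fix g and i :: nat assume g: "g \<in> carrier (arc_group 9 3 f933)" and i: "i \<in> {1..3}" and gi: "g i = i"
    obtain k where k: "g = rot3 k" using g sub by (auto simp: arc_group_def)
    have "k mod 3 = 0" using gi unfolding k rot3_apply_eq_iff[OF i i] by simp
    thus "g = \<one>\<^bsub>arc_group 9 3 f933\<^esub>" unfolding k using rot3_id by (simp add: arc_group_def sym_group_one)
  qed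
qed

lemma abelian_drackn_f933: "abelian_drackn 9 3 3 f933" "m_tau_bar 9 3 3 f933 = 3"
proof -
  interpret uniform_arc_fun 9 3 f933 3
    using arc_function_f933 uniform_f933 by unfold_locales simp_all
  have "normalized 9 3 f933"
    by (rule normalizedI) (simp_all add: f933_def symplectic3_def rot3_id)
  thus "abelian_drackn 9 3 3 f933"
    using arc arc_group_f933 drackn_G by (simp add: abelian_drackn_def)
  \<comment> \<open>Here \<open>\<delta> = -2\<close> and the discriminant is
    \<open>4 + 4 * 8 = 36\<close>. Then \<open>m_tau * 6 = 9 * 2 * 2\<close>, so the multiplicity is
    6 and its quotient by \<open>r - 1 = 2\<close> is 3.\<close>
  have "sqrt 36 = (6 :: real)" by (rule real_sqrt_unique) simp_all
  hence "tau 9 3 3 = -4" "theta 9 3 3 = 2" by (simp_all add: theta_def tau_def delta_def)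
  with m_tau_eq show "m_tau_bar 9 3 3 f933 = 3" by (simp add: m_tau_bar_def)
qed

theorem corollary6p7:
  fixes n r c :: nat
  shows "(\<exists>f. abelian_drackn n r c f \<and> real n = (m_tau_bar n r c f)\<^sup>2)
         \<longleftrightarrow> (n, r, c) = (9, 3, 3)"
proof
  assume "\<exists>f. abelian_drackn n r c f \<and> real n = (m_tau_bar n r c f)\<^sup>2"
  then obtain f where ab: "abelian_drackn n r c f" and max: "real n = (m_tau_bar n r c f)\<^sup>2" by blast
  interpret arc_fun n r f using ab by unfold_locales (simp add: abelian_drackn_def)
  have dr: "drackn G (fibres n r) n r c" using ab by (simp add: abelian_drackn_def)
  interpret uniform_arc_fun n r f c
    using uniform_of_drackn[OF dr] dr by unfold_locales (simp_all add: drackn_def)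
  show "(n, r, c) = (9, 3, 3)"
    using ab max by (intro abelian_maximal_parameters) (simp_all add: abelian_drackn_def)
next
  assume "(n, r, c) = (9, 3, 3)"
  thus "\<exists>f. abelian_drackn n r c f \<and> real n = (m_tau_bar n r c f)\<^sup>2"
    using abelian_drackn_f933 by (intro exI[of _ f933]) simp
qed

end
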